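(* Let $n\ge 1$, let $\{b_{ij}:1\le j\le i\le n\}$ be given real scalars, and let $\{g_{ij}:1\le j\le i\le n\}$ be i.i.d. $N(0,1)$ random variables. Let $X$ be the $n\times n$ symmetric random matrix with $X_{ij}=X_{ji}=g_{ij}b_{ij}$ for $i\ge j$. Set $b_{ij}:=b_{ji}$ for $i<j$ and define $$\sigma:=\max_i\sqrt{\sum_j b_{ij}^2},\qquad \sigma_*:=\max_{ij}|b_{ij}|.$$ Then for any $0<\varepsilon\le 1/2$, $$\mathbb{E}\|X\|\le (1+\varepsilon)\Big\{2\sigma+\frac{6}{\sqrt{\log(1+\varepsilon)}}\,\sigma_*\sqrt{\log n}\Big\}.$$
   Context: $\|\cdot\|$ denotes the spectral (operator) norm and $\log$ the natural logarithm. *)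

theory Defs
  imports "HOL-Probability.Probability"
begin

definition gauss_sym_matrix ::
  "('n::{finite,linorder} \<Rightarrow> 'n \<Rightarrow> 'a \<Rightarrow> real) \<Rightarrow> ('n \<Rightarrow> 'n \<Rightarrow> real) \<Rightarrow> 'a \<Rightarrow> ((real, 'n) vec, 'n) vec" where
  "gauss_sym_matrix g b \<omega> = (\<chi> i j. if j \<le> i then g i j \<omega> * b i j else g j i \<omega> * b j i)"

definition spec_norm :: "real^'n^'n \<Rightarrow> real" where
  "spec_norm A = onorm (\<lambda>v. A *v v)"

end

theory Submission
  imports Defs
begin

text \<open>
  Normalise so that all \<open>\<bar>b i j\<bar> \<le> 1\<close>, with row norms at most \<open>\<sigma>\<close>, and bound the norm by the
  moment \<open>E Tr X ^ (2 p)\<close> with \<open>p\<close> of order \<open>ln n / ln (1 + \<epsilon>)\<close>. A closed walk contributes to this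
  moment only if it uses each edge an even number of times; keeping the edges that discover new
  vertices and bounding the others by 1, walks of a given shape with \<open>k + 1\<close> vertices contribute at
  most \<open>n \<sigma> ^ (2 k)\<close> times a coefficient depending only on the shape. In the Gaussian orthogonal
  ensemble \<open>Y\<close> of dimension \<open>r = \<lceil>\<sigma> ^ 2\<rceil> + p\<close> the same shape contributes at least \<open>r \<sigma> ^ (2 k)\<close> times
  this coefficient, hence \<open>E Tr X ^ (2 p) \<le> (n / r) E Tr Y ^ (2 p)\<close>.

  The moments \<open>E (Tr Y ^ k1 \<cdots> Tr Y ^ km)\<close> satisfy the loop equations obtained by Gaussian
  integration by parts. These express a moment as a nonnegative combination of moments of lower
  degree, so any supersolution is an upper bound. An explicit one, made of Catalan numbers and a
  geometric term, gives \<open>E Tr Y ^ (2 p) \<le> r (2 sqrt (r + p) + 2 sqrt p) ^ (2 p)\<close>.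
\<close>

section \<open>Wick's formula\<close>

text \<open>The loop equations do not close on single traces: splitting one trace produces a product
  of two, whose expectation does not factor, so the induction has to run over all products. Odd
  traces are the obstacle there. Each has mean zero, but E (Tr Y)^2 = 2 r, so a product of bounds
  for single traces is no candidate for an upper bound; a pair of odd traces therefore gets a weight
  of its own.

  The constant 6 is 4 + 2. The dimension satisfies r \<le> \<sigma>^2 + 1 + p, hence r + p \<le>
  (\<sigma> + 2 sqrt p)^2 and 2 sqrt (r + p) \<le> 2 \<sigma> + 4 sqrt p; the other 2 sqrt p is the
  excess in the moment bound for Y. The factor n that is left over is at most (1 + \<epsilon>) ^ (2
  p), which after a root of order 2 p becomes the factor 1 + \<epsilon>.\<close>

definition del_nth :: "nat \<Rightarrow> 'a list \<Rightarrow> 'a list" where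
  "del_nth j L = take j L @ drop (Suc j) L"

lemma length_del_nth: "j < length L \<Longrightarrow> length (del_nth j L) = length L - 1"
  by (simp add: del_nth_def)

lemma del_nth_Cons_Suc [simp]: "del_nth (Suc j) (x # L) = x # del_nth j L"
  and del_nth_Cons_0 [simp]: "del_nth 0 (x # L) = L"
  by (simp_all add: del_nth_def)

lemma map_del_nth: "map f (del_nth j L) = del_nth j (map f L)"
  by (simp add: del_nth_def take_map drop_map)

lemma set_del_nth_subset: "set (del_nth j L) \<subseteq> set L"
  by (auto simp: del_nth_def dest: in_set_takeD in_set_dropD)

lemma prod_list_del_nth:
  fixes L :: "'a::comm_monoid_mult list"
  assumes "j < length L"
  shows "L ! j * prod_list (del_nth j L) = prod_list L"
proof -
  have "L = take j L @ L ! j # drop (Suc j) L" using assms by (rule id_take_nth_drop)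
  then have "prod_list L = prod_list (take j L) * (L ! j * prod_list (drop (Suc j) L))"
    by (metis prod_list.Cons prod_list.append)
  then show ?thesis by (simp add: del_nth_def mult_ac)
qed

lemma count_list_del_nth:
  assumes "j < length L"
  shows "count_list (del_nth j L) i = count_list L i - (if L ! j = i then 1 else 0)"
proof -
  have "L = take j L @ L ! j # drop (Suc j) L" using assms by (rule id_take_nth_drop)
  then have "count_list L i = count_list (take j L) i + count_list (L ! j # drop (Suc j) L) i"
    by (metis count_list_append)
  then show ?thesis by (auto simp: del_nth_def)
qed

text \<open>The sum over all perfect matchings of the list of the product of \<kappa> over matched
  pairs (a hafnian). Odd lengths give 0, since a single remaining letter has an empty sum over
  partners.\<close>

function wick :: "('e \<Rightarrow> 'e \<Rightarrow> real) \<Rightarrow> 'e list \<Rightarrow> real" where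
  "wick \<kappa> [] = 1"
| "wick \<kappa> (e # L) = (\<Sum>j<length L. \<kappa> e (L ! j) * wick \<kappa> (del_nth j L))"
  by pat_completeness auto
termination
  by (relation "Wellfounded.measure (\<lambda>(\<kappa>, L). length L)") (auto simp: del_nth_def)

lemma wick_map: "wick \<kappa> (map f L) = wick (\<lambda>x y. \<kappa> (f x) (f y)) L"
proof (induction "length L" arbitrary: L rule: less_induct)
  case less
  show ?case
  proof (cases L)
    case (Cons e L')
    show ?thesis unfolding Cons list.map wick.simps
      by (intro sum.cong) (auto simp: less Cons length_del_nth map_del_nth[symmetric])
  qed simp
qed

lemma wick_mono:
  assumes "\<And>e f. e \<in> set L \<Longrightarrow> f \<in> set L \<Longrightarrow> 0 \<le> \<kappa> e f \<and> \<kappa> e f \<le> \<kappa>' e f"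
  shows "0 \<le> wick \<kappa> L \<and> wick \<kappa> L \<le> wick \<kappa>' L"
  using assms
proof (induction "length L" arbitrary: L rule: less_induct)
  case less
  show ?case
  proof (cases L)
    case (Cons e L')
    have *: "0 \<le> wick \<kappa> (del_nth j L') \<and> wick \<kappa> (del_nth j L') \<le> wick \<kappa>' (del_nth j L')"
      if "j < length L'" for j
      using less.prems set_del_nth_subset[of j L'] that
      by (intro less.hyps) (auto simp: Cons length_del_nth)
    have **: "0 \<le> \<kappa> e (L' ! j) \<and> \<kappa> e (L' ! j) \<le> \<kappa>' e (L' ! j)" if "j < length L'" for j
      using less.prems that by (auto simp: Cons)
    show ?thesis unfolding Cons wick.simps
      using * ** by (auto intro!: sum_nonneg sum_mono mult_mono intro: order_trans)
  qed simp
qed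

lemma wick_cong:
  assumes "\<And>e f. e \<in> set L \<Longrightarrow> f \<in> set L \<Longrightarrow> \<kappa> e f = \<kappa>' e f"
  shows "wick \<kappa> L = wick \<kappa>' L"
  using assms
proof (induction "length L" arbitrary: L rule: less_induct)
  case less
  show ?case
  proof (cases L)
    case (Cons e L')
    have "wick \<kappa> (del_nth j L') = wick \<kappa>' (del_nth j L')" if "j < length L'" for j
      using less.prems set_del_nth_subset[of j L'] that
      by (intro less.hyps) (auto simp: Cons length_del_nth)
    then show ?thesis unfolding Cons wick.simps using less.prems by (simp add: Cons)
  qed simp
qed

lemma wick_scale:
  "wick (\<lambda>e f. s e * s f * \<kappa> e f) L = prod_list (map s L) * wick \<kappa> L"
proof (induction "length L" arbitrary: L rule: less_induct)
  case less
  show ?case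
  proof (cases L)
    case (Cons e L')
    have "s e * s (L' ! j) * \<kappa> e (L' ! j) * wick (\<lambda>e f. s e * s f * \<kappa> e f) (del_nth j L')
        = s e * prod_list (map s L') * (\<kappa> e (L' ! j) * wick \<kappa> (del_nth j L'))"
      if "j < length L'" for j
      using less[of "del_nth j L'"] prod_list_del_nth[of j "map s L'"] that
      by (simp add: Cons length_del_nth map_del_nth)
    then have "wick (\<lambda>e f. s e * s f * \<kappa> e f) L
        = (\<Sum>j<length L'. s e * prod_list (map s L') * (\<kappa> e (L' ! j) * wick \<kappa> (del_nth j L')))"
      unfolding Cons wick.simps by (intro sum.cong refl) (simp only: lessThan_iff)
    then show ?thesis by (simp add: Cons sum_distrib_left mult.assoc)
  qed simp
qed

section \<open>Moments of independent standard normal variables\<close>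

definition gauss_moment :: "nat \<Rightarrow> real" where
  "gauss_moment k = (\<integral>x. std_normal_density x * x ^ k \<partial>lborel)"

text \<open>Gaussian integration by parts for monomials, read off the explicit moments. At
  \<open>k = 0\<close> the truncated \<open>k - 1\<close> is harmless because of the factor
  \<open>k\<close>.\<close>

lemma gauss_moment_Suc: "gauss_moment (Suc k) = real k * gauss_moment (k - 1)"
proof (cases "even k")
  case True
  then obtain m where m: "k = 2 * m" by blast
  have z: "gauss_moment (2 * j + 1) = 0" for j
    using has_bochner_integral_integral_eq[OF std_normal_moment_odd[of j]] by (simp add: gauss_moment_def)
  show ?thesis
  proof (cases m)
    case (Suc j)
    then have "k - 1 = 2 * j + 1" by (simp add: m)
    then show ?thesis using z[of m] z[of j] m by simp
  qed (use z[of 0] m in simp)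
next
  case False
  then obtain m where m: "k = 2 * m + 1" by (metis oddE)
  have e: "gauss_moment (2 * j) = fact (2 * j) / (2 ^ j * fact j)" for j
    using has_bochner_integral_integral_eq[OF std_normal_moment_even[of j]] by (simp add: gauss_moment_def)
  have "gauss_moment (Suc k) = gauss_moment (2 * Suc m)" by (simp add: m)
  also have "\<dots> = real k * gauss_moment (2 * m)"
    unfolding e m by (simp add: divide_simps)
  finally show ?thesis by (simp add: m)
qed

lemma gauss_moment_0: "gauss_moment 0 = 1"
  using has_bochner_integral_integral_eq[OF std_normal_moment_even[of 0]] by (simp add: gauss_moment_def)

lemma prod_list_map_count:
  fixes f :: "'i \<Rightarrow> 'b::comm_monoid_mult"
  assumes "finite K" "set L \<subseteq> K"
  shows "prod_list (map f L) = (\<Prod>i\<in>K. f i ^ count_list L i)"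
  using assms(2)
proof (induction L)
  case (Cons e L)
  have "(\<Prod>i\<in>K. f i ^ count_list (e # L) i) = (\<Prod>i\<in>K. (if i = e then f i else 1) * f i ^ count_list L i)"
    by (intro prod.cong) auto
  also have "\<dots> = f e * (\<Prod>i\<in>K. f i ^ count_list L i)"
    using Cons.prems assms(1) by (simp add: prod.distrib prod.delta)
  finally show ?case using Cons by simp
qed simp

text \<open>The head can be matched with any of its remaining copies, and every choice leaves the
  same product with the count lowered by one. So the recursion of \<open>wick\<close> is the moment
  recursion in the variable at the head.\<close>

lemma wick_eq_gauss_moments:
  assumes "finite K" "set L \<subseteq> K"
  shows "wick (\<lambda>i j. of_bool (i = j)) L = (\<Prod>i\<in>K. gauss_moment (count_list L i))"
  using assms(2)
proof (induction "length L" arbitrary: L rule: less_induct)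
  case less
  show ?case
  proof (cases L)
    case Nil
    then show ?thesis by (simp add: gauss_moment_0)
  next
    case (Cons e L')
    let ?c = "count_list L' e"
    have eK: "e \<in> K" using less.prems Cons by simp
    let ?R = "\<Prod>i\<in>K-{e}. gauss_moment (count_list L' i)"
    have *: "of_bool (e = L' ! j) * wick (\<lambda>i j. of_bool (i = j)) (del_nth j L')
          = of_bool (e = L' ! j) * (gauss_moment (?c - 1) * ?R)" if j: "j < length L'" for j
    proof (cases "e = L' ! j")
      case True
      have "wick (\<lambda>i j. of_bool (i = j)) (del_nth j L')
          = (\<Prod>i\<in>K. gauss_moment (count_list (del_nth j L') i))"
        using less.prems set_del_nth_subset[of j L'] j
        by (intro less.hyps) (auto simp: Cons length_del_nth)
      also have "\<dots> = gauss_moment (?c - 1) * ?R"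
        unfolding prod.remove[OF assms(1) eK] using j True
        by (intro arg_cong2[of _ _ _ _ "(*)"] prod.cong) (auto simp: count_list_del_nth)
      finally show ?thesis by simp
    qed simp
    have cnt: "(\<Sum>j<length xs. of_bool (e = xs ! j)) = real (count_list xs e)" for xs
    proof (induction xs)
      case (Cons a L'')
      show ?case unfolding list.size(4) add_0_right add_Suc_right
        using Cons.IH by (subst sum.lessThan_Suc_shift) auto
    qed simp
    have "wick (\<lambda>i j. of_bool (i = j)) L = (\<Sum>j<length L'. of_bool (e = L' ! j) * (gauss_moment (?c - 1) * ?R))"
      unfolding Cons wick.simps by (intro sum.cong refl *) simp
    also have "\<dots> = real ?c * gauss_moment (?c - 1) * ?R"
      by (simp add: sum_distrib_right[symmetric] cnt)
    also have "\<dots> = gauss_moment (Suc ?c) * ?R" by (simp add: gauss_moment_Suc)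
    also have "\<dots> = (\<Prod>i\<in>K. gauss_moment (count_list L i))"
      unfolding prod.remove[OF assms(1) eK] Cons
      by (intro arg_cong2[of _ _ _ _ "(*)"] prod.cong) auto
    finally show ?thesis .
  qed
qed

lemma (in prob_space) wick_formula_iid:
  fixes G :: "'i \<Rightarrow> 'a \<Rightarrow> real"
  assumes fin: "finite K" and ind: "indep_vars (\<lambda>_. borel) G K"
    and dist: "\<And>i. i \<in> K \<Longrightarrow> distributed M lborel (G i) std_normal_density"
    and L: "set L \<subseteq> K"
  shows "integrable M (\<lambda>\<omega>. \<Prod>i\<leftarrow>L. G i \<omega>)"
    and "expectation (\<lambda>\<omega>. \<Prod>i\<leftarrow>L. G i \<omega>) = wick (\<lambda>i j. of_bool (i = j)) L"
proof -
  have eq: "(\<lambda>\<omega>. \<Prod>i\<leftarrow>L. G i \<omega>) = (\<lambda>\<omega>. \<Prod>i\<in>K. G i \<omega> ^ count_list L i)"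
    by (rule ext) (rule prod_list_map_count[OF fin L])
  have ind': "indep_vars (\<lambda>_. borel) (\<lambda>i \<omega>. G i \<omega> ^ count_list L i) K"
    using indep_vars_compose2[OF ind, of "\<lambda>i x. x ^ count_list L i" "\<lambda>_. borel"] by simp
  have mom: "integrable M (\<lambda>\<omega>. G i \<omega> ^ k)" "expectation (\<lambda>\<omega>. G i \<omega> ^ k) = gauss_moment k"
    if "i \<in> K" for i k
  proof -
    show "integrable M (\<lambda>\<omega>. G i \<omega> ^ k)"
      using distributed_integrable[OF dist[OF that], of "\<lambda>x. x ^ k"] integrable_std_normal_moment[of k]
      by simp
    show "expectation (\<lambda>\<omega>. G i \<omega> ^ k) = gauss_moment k"
      using distributed_integral[OF dist[OF that], of "\<lambda>x. x ^ k"] by (simp add: gauss_moment_def)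
  qed
  show "integrable M (\<lambda>\<omega>. \<Prod>i\<leftarrow>L. G i \<omega>)"
    unfolding eq by (intro indep_vars_integrable[OF fin ind'] mom(1))
  show "expectation (\<lambda>\<omega>. \<Prod>i\<leftarrow>L. G i \<omega>) = wick (\<lambda>i j. of_bool (i = j)) L"
    unfolding eq using indep_vars_lebesgue_integral[OF fin ind' mom(1)]
    by (simp add: mom wick_eq_gauss_moments[OF fin L])
qed

text \<open>Entries at mirrored positions are the same variable, so letters are sent by \<phi> to
  independent variables and scaled by \<open>s\<close>. The given matrix and the orthogonal ensemble
  are both instances, with \<phi> the canonical edge.\<close>

lemma (in prob_space) wick_formula:
  fixes G :: "'i \<Rightarrow> 'a \<Rightarrow> real" and s :: "'e \<Rightarrow> real" and \<phi> :: "'e \<Rightarrow> 'i"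
  assumes fin: "finite K" and ind: "indep_vars (\<lambda>_. borel) G K"
    and dist: "\<And>i. i \<in> K \<Longrightarrow> distributed M lborel (G i) std_normal_density"
    and L: "\<phi> ` set L \<subseteq> K"
  shows "integrable M (\<lambda>\<omega>. \<Prod>e\<leftarrow>L. s e * G (\<phi> e) \<omega>)"
    and "expectation (\<lambda>\<omega>. \<Prod>e\<leftarrow>L. s e * G (\<phi> e) \<omega>)
           = wick (\<lambda>e f. s e * s f * of_bool (\<phi> e = \<phi> f)) L"
proof -
  have eq: "(\<Prod>e\<leftarrow>L. s e * G (\<phi> e) \<omega>) = prod_list (map s L) * (\<Prod>i\<leftarrow>map \<phi> L. G i \<omega>)" for \<omega>
    by (induction L) (auto simp: mult_ac)
  note * = wick_formula_iid[OF fin ind dist, of "map \<phi> L"]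
  show "integrable M (\<lambda>\<omega>. \<Prod>e\<leftarrow>L. s e * G (\<phi> e) \<omega>)"
    unfolding eq using * L by simp
  show "expectation (\<lambda>\<omega>. \<Prod>e\<leftarrow>L. s e * G (\<phi> e) \<omega>)
           = wick (\<lambda>e f. s e * s f * of_bool (\<phi> e = \<phi> f)) L"
    unfolding eq wick_scale using *(2) L by (simp add: wick_map)
qed

section \<open>Powers of a symmetric matrix and the spectral norm\<close>

text \<open>Matrices are functions on an index set because the dimension \<open>r\<close> of the
  comparison ensemble is computed from \<sigma> and \<open>p\<close>, so it cannot be a
  type.\<close>

primrec mat_power :: "'i set \<Rightarrow> ('i \<Rightarrow> 'i \<Rightarrow> real) \<Rightarrow> nat \<Rightarrow> 'i \<Rightarrow> 'i \<Rightarrow> real" where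
  "mat_power I A 0 a b = of_bool (a = b)"
| "mat_power I A (Suc m) a b = (\<Sum>c\<in>I. A a c * mat_power I A m c b)"

definition trace_power :: "'i set \<Rightarrow> ('i \<Rightarrow> 'i \<Rightarrow> real) \<Rightarrow> nat \<Rightarrow> real" where
  "trace_power I A m = (\<Sum>a\<in>I. mat_power I A m a a)"

lemma mat_power_add:
  assumes "finite I" "a \<in> I"
  shows "mat_power I A (s + t) a b = (\<Sum>c\<in>I. mat_power I A s a c * mat_power I A t c b)"
  using assms(2)
proof (induction s arbitrary: a)
  case 0
  have "(\<Sum>c\<in>I. mat_power I A 0 a c * mat_power I A t c b) = (\<Sum>c\<in>I. if a = c then mat_power I A t c b else 0)"
    by (intro sum.cong) auto
  then show ?case using assms(1) 0 by simp
next
  case (Suc s)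
  have "mat_power I A (Suc s + t) a b = (\<Sum>d\<in>I. A a d * (\<Sum>c\<in>I. mat_power I A s d c * mat_power I A t c b))"
    using Suc by simp
  also have "\<dots> = (\<Sum>c\<in>I. \<Sum>d\<in>I. A a d * mat_power I A s d c * mat_power I A t c b)"
    unfolding sum_distrib_left by (subst sum.swap) (simp add: mult.assoc)
  finally show ?case by (simp add: sum_distrib_right)
qed

lemma mat_power_1:
  assumes "finite I" "b \<in> I"
  shows "mat_power I A 1 a b = A a b"
proof -
  have "mat_power I A 1 a b = (\<Sum>c\<in>I. if c = b then A a c else 0)"
    by (auto intro!: sum.cong)
  then show ?thesis using assms by simp
qed

lemma mat_power_sym:
  assumes "finite I" and sym: "\<And>a b. a \<in> I \<Longrightarrow> b \<in> I \<Longrightarrow> A a b = A b a"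
  shows "a \<in> I \<Longrightarrow> b \<in> I \<Longrightarrow> mat_power I A m a b = mat_power I A m b a"
proof (induction m arbitrary: a b)
  case (Suc m)
  have "mat_power I A (Suc m) a b = (\<Sum>c\<in>I. mat_power I A m b c * mat_power I A 1 c a)"
    using Suc sym mat_power_1[OF assms(1) Suc.prems(1), of A] by (simp add: mult.commute)
  then show ?case using mat_power_add[OF assms(1) Suc.prems(2), of A m 1 a] by simp
qed auto

lemma trace_power_double:
  assumes "finite I" "\<And>a b. a \<in> I \<Longrightarrow> b \<in> I \<Longrightarrow> A a b = A b a"
  shows "trace_power I A (2 * m) = (\<Sum>a\<in>I. \<Sum>b\<in>I. (mat_power I A m a b)\<^sup>2)"
  unfolding trace_power_def mult_2 using mat_power_sym[OF assms]
  by (simp add: mat_power_add[OF assms(1)] power2_eq_square)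

section \<open>The spectral norm against traces of powers\<close>

text \<open>Log-convexity makes the ratios \<open>a (k + 1) / a k\<close> nondecreasing, so each is
  at least the first one, \<open>a 1\<close>. Stated without division because the sequence may
  vanish.\<close>

lemma log_convex_power_le:
  fixes a :: "nat \<Rightarrow> real"
  assumes nonneg: "\<And>k. 0 \<le> a k" and "a 0 = 1"
    and lc: "\<And>k. (a (Suc k))\<^sup>2 \<le> a k * a (Suc (Suc k))"
  shows "a 1 ^ p \<le> a p"
proof -
  have step: "a 1 * a k \<le> a (Suc k)" for k
  proof (induction k)
    case (Suc k)
    show ?case
    proof (cases "a k = 0")
      case True
      then have "a (Suc k) = 0" using lc[of k] by simp
      then show ?thesis using nonneg by simp
    next
      case False
      have "a k * (a 1 * a (Suc k)) = (a 1 * a k) * a (Suc k)" by simp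
      also have "\<dots> \<le> a (Suc k) * a (Suc k)" using Suc nonneg by (intro mult_right_mono)
      also have "\<dots> \<le> a k * a (Suc (Suc k))" using lc[of k] by (simp add: power2_eq_square)
      finally show ?thesis using False nonneg[of k] by simp
    qed
  qed (simp add: assms)
  show ?thesis
  proof (induction p)
    case (Suc p)
    then have "a 1 * a 1 ^ p \<le> a 1 * a p" using nonneg by (intro mult_left_mono)
    then show ?case using step[of p] by simp
  qed (simp add: assms)
qed

lemma spec_norm_nonneg: "0 \<le> spec_norm A"
  unfolding spec_norm_def by (rule onorm_pos_le) (simp add: linear_conv_bounded_linear[symmetric])

text \<open>No diagonalisation: for a unit vector v, |A v|^p \<le> |A^p v|, and |A^p v| is at most
  the Frobenius norm of A^p, whose square is the trace of A^(2p).\<close>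

lemma spec_norm_power_le_trace:
  fixes A :: "real^'n^'n"
  assumes sym: "\<And>i j. A $ i $ j = A $ j $ i" and p: "p > 0"
  shows "spec_norm A ^ (2 * p) \<le> trace_power UNIV (\<lambda>i j. A $ i $ j) (2 * p)"
proof -
  let ?f = "\<lambda>v. A *v v" and ?A = "\<lambda>i j. A $ i $ j"
  let ?T = "trace_power UNIV ?A (2 * p)"
  have T0: "0 \<le> ?T" using sym by (subst trace_power_double) (auto intro!: sum_nonneg)
  have lin: "linear ?f" by simp
  have comp: "(?f ^^ k) v $ a = (\<Sum>b\<in>UNIV. mat_power UNIV ?A k a b * v $ b)" for k v a
  proof (induction k arbitrary: a)
    case 0
    have "(\<Sum>b\<in>UNIV. mat_power UNIV ?A 0 a b * v $ b) = (\<Sum>b\<in>UNIV. if a = b then v $ b else 0)"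
      by (intro sum.cong) auto
    then show ?case by simp
  next
    case (Suc k)
    have "(?f ^^ Suc k) v $ a = (\<Sum>c\<in>UNIV. A $ a $ c * (\<Sum>b\<in>UNIV. mat_power UNIV ?A k c b * v $ b))"
      using Suc by (simp add: matrix_vector_mult_def)
    also have "\<dots> = (\<Sum>b\<in>UNIV. \<Sum>c\<in>UNIV. A $ a $ c * mat_power UNIV ?A k c b * v $ b)"
      unfolding sum_distrib_left by (subst sum.swap) (simp add: mult.assoc)
    finally show ?case by (simp add: sum_distrib_right)
  qed
  have selfadj: "?f u \<bullet> v = u \<bullet> ?f v" for u v
  proof -
    have "u v* A = A *v u"
      by (simp add: vec_eq_iff vector_matrix_mult_def matrix_vector_mult_def sym mult.commute)
    then show ?thesis by (metis dot_lmul_matrix)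
  qed
  have bound: "norm (?f v) \<le> root (2 * p) ?T" if v: "norm v = 1" for v
  proof -
    \<comment> \<open>Self-adjointness gives |A^(k+1) v|^2 = <A^k v, A^(k+2) v>, so by
      Cauchy-Schwarz this sequence is log-convex.\<close>
    define a where "a k = norm ((?f ^^ k) v)" for k
    have "(a (Suc k))\<^sup>2 \<le> a k * a (Suc (Suc k))" for k
    proof -
      have "(a (Suc k))\<^sup>2 = (?f ^^ Suc k) v \<bullet> (?f ^^ Suc k) v"
        unfolding a_def by (rule power2_norm_eq_inner)
      also have "\<dots> = (?f ^^ k) v \<bullet> (?f ^^ Suc (Suc k)) v"
        using selfadj[of "(?f ^^ k) v" "(?f ^^ Suc k) v"] by simp
      also have "\<dots> \<le> a k * a (Suc (Suc k))" unfolding a_def by (rule norm_cauchy_schwarz)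
      finally show ?thesis .
    qed
    then have "a 1 ^ p \<le> a p" by (intro log_convex_power_le) (auto simp: a_def v)
    then have "(a 1 ^ p)\<^sup>2 \<le> (a p)\<^sup>2" by (intro power_mono) (auto simp: a_def)
    also have "(a p)\<^sup>2 = (\<Sum>i\<in>UNIV. (\<Sum>b\<in>UNIV. mat_power UNIV ?A p i b * v $ b)\<^sup>2)"
      unfolding a_def power2_norm_eq_inner inner_vec_def comp by (simp add: power2_eq_square)
    also have "\<dots> \<le> (\<Sum>i\<in>UNIV. (\<Sum>b\<in>UNIV. (mat_power UNIV ?A p i b)\<^sup>2) * (\<Sum>b\<in>UNIV. (v $ b)\<^sup>2))"
      by (intro sum_mono Cauchy_Schwarz_ineq_sum)
    also have "(\<Sum>b\<in>UNIV. (v $ b)\<^sup>2) = 1"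
      using power2_norm_eq_inner[of v] v by (simp add: inner_vec_def power2_eq_square)
    finally have "(a 1 ^ p)\<^sup>2 \<le> ?T"
      using sym by (subst trace_power_double) auto
    then have "a 1 ^ (2 * p) \<le> ?T" by (simp only: power_mult[symmetric] mult.commute[of p 2])
    then have "root (2 * p) (a 1 ^ (2 * p)) \<le> root (2 * p) ?T" using p by simp
    then show ?thesis using p by (simp add: real_root_power_cancel a_def)
  qed
  have "norm (?f v) \<le> root (2 * p) ?T * norm v" for v
  proof (cases "v = 0")
    case False
    have "norm (?f ((1 / norm v) *\<^sub>R v)) \<le> root (2 * p) ?T" using False by (intro bound) simp
    then show ?thesis using False by (simp add: matrix_vector_mult_scaleR field_simps)
  qed simp
  then have "spec_norm A \<le> root (2 * p) ?T" unfolding spec_norm_def by (rule onorm_le)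
  then have "spec_norm A ^ (2 * p) \<le> root (2 * p) ?T ^ (2 * p)" using spec_norm_nonneg by (rule power_mono)
  then show ?thesis using p T0 by simp
qed

section \<open>Continuity of the spectral norm, used for measurability\<close>

lemma abs_spec_norm_diff_le:
  fixes A B :: "real^'n^'n"
  shows "\<bar>spec_norm A - spec_norm B\<bar> \<le> spec_norm (A - B)"
proof -
  have bl: "bounded_linear (\<lambda>v. C *v v)" for C :: "real^'n^'n"
    by (simp add: linear_conv_bounded_linear[symmetric])
  have "spec_norm (C + D) \<le> spec_norm C + spec_norm D" for C D :: "real^'n^'n"
    using onorm_triangle[OF bl bl, of C D] by (simp add: spec_norm_def matrix_vector_mult_add_rdistrib)
  from this[of "A - B" B] this[of "B - A" A]
  have "spec_norm A \<le> spec_norm (A - B) + spec_norm B" "spec_norm B \<le> spec_norm (B - A) + spec_norm A"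
    by simp_all
  moreover have "spec_norm (B - A) = spec_norm (A - B)"
    using onorm_neg[of "\<lambda>v. (A - B) *v v"] 
    by (simp add: spec_norm_def matrix_vector_mult_diff_rdistrib)
  ultimately show ?thesis by linarith
qed

lemma spec_norm_le_sum:
  fixes A :: "real^'n^'n"
  shows "spec_norm A \<le> (\<Sum>i\<in>UNIV. \<Sum>j\<in>UNIV. \<bar>A $ i $ j\<bar>)"
  unfolding spec_norm_def
proof (rule onorm_le)
  fix v :: "real^'n"
  have "norm (A *v v) \<le> (\<Sum>i\<in>UNIV. \<bar>(A *v v) $ i\<bar>)" by (rule norm_le_l1_cart)
  also have "\<dots> \<le> (\<Sum>i\<in>UNIV. \<Sum>j\<in>UNIV. \<bar>A $ i $ j\<bar> * norm v)"
    unfolding matrix_vector_mult_def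
    by (auto intro!: sum_mono order_trans[OF sum_abs] mult_left_mono component_le_norm_cart simp: abs_mult)
  finally show "norm (A *v v) \<le> (\<Sum>i\<in>UNIV. \<Sum>j\<in>UNIV. \<bar>A $ i $ j\<bar>) * norm v"
    by (simp add: sum_distrib_right)
qed

lemma continuous_on_spec_norm: "continuous_on UNIV (spec_norm :: real^'n^'n \<Rightarrow> real)"
proof (intro continuous_at_imp_continuous_on ballI)
  fix A :: "real^'n^'n"
  have "((\<lambda>B. \<Sum>i\<in>UNIV. \<Sum>j\<in>UNIV. \<bar>(B - A) $ i $ j\<bar>) \<longlongrightarrow> (\<Sum>i\<in>UNIV. \<Sum>j\<in>UNIV. \<bar>(A - A) $ i $ j\<bar>)) (at A)"
    by (intro tendsto_intros)
  then have "((\<lambda>B. \<Sum>i\<in>UNIV. \<Sum>j\<in>UNIV. \<bar>(B - A) $ i $ j\<bar>) \<longlongrightarrow> 0) (at A)" by simp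
  then have "((\<lambda>B. spec_norm B - spec_norm A) \<longlongrightarrow> 0) (at A)"
    by (rule Lim_null_comparison[rotated])
       (auto intro!: always_eventually order_trans[OF abs_spec_norm_diff_le] order_trans[OF spec_norm_le_sum])
  then show "isCont spec_norm A" unfolding isCont_def by (simp add: LIM_zero_iff)
qed

section \<open>Loop equations of the Gaussian orthogonal ensemble\<close>

text \<open>With independent entries of variance 1 off and 2 on the diagonal, the covariance splits
  into two rank-one parts, which is what makes the loop equations below close up.\<close>

definition goe_cov :: "'i \<times> 'i \<Rightarrow> 'i \<times> 'i \<Rightarrow> real" where
  "goe_cov e f = of_bool (fst e = fst f \<and> snd e = snd f) + of_bool (fst e = snd f \<and> snd e = fst f)"

lemma integral_sum_sum:
  fixes f :: "'b \<Rightarrow> 'c \<Rightarrow> 'a \<Rightarrow> real"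
  assumes "\<And>a b. a \<in> A \<Longrightarrow> b \<in> B \<Longrightarrow> integrable M (f a b)"
  shows "(\<integral>\<omega>. (\<Sum>a\<in>A. \<Sum>b\<in>B. f a b \<omega>) \<partial>M) = (\<Sum>a\<in>A. \<Sum>b\<in>B. \<integral>\<omega>. f a b \<omega> \<partial>M)"
  using assms
  by (subst Bochner_Integration.integral_sum)
     (auto intro!: sum.cong Bochner_Integration.integral_sum Bochner_Integration.integrable_sum)

text \<open>The ensemble enters only through the symmetry and the joint moments of its entries, so
  these are the axioms; a model is constructed separately.\<close>

locale goe = prob_space M for M :: "'a measure" +
  fixes Y :: "nat \<Rightarrow> nat \<Rightarrow> 'a \<Rightarrow> real" and r :: nat
  assumes Y_sym: "Y a b \<omega> = Y b a \<omega>"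
    and integrable_monomial:
      "set L \<subseteq> {..<r} \<times> {..<r} \<Longrightarrow> integrable M (\<lambda>\<omega>. \<Prod>e\<leftarrow>L. Y (fst e) (snd e) \<omega>)"
    and expectation_monomial:
      "set L \<subseteq> {..<r} \<times> {..<r} \<Longrightarrow> expectation (\<lambda>\<omega>. \<Prod>e\<leftarrow>L. Y (fst e) (snd e) \<omega>) = wick goe_cov L"
begin

abbreviation mon :: "(nat \<times> nat) list \<Rightarrow> 'a \<Rightarrow> real" where
  "mon L \<omega> \<equiv> (\<Prod>e\<leftarrow>L. Y (fst e) (snd e) \<omega>)"

abbreviation W :: "nat \<Rightarrow> nat \<Rightarrow> nat \<Rightarrow> 'a \<Rightarrow> real" where
  "W m a b \<omega> \<equiv> mat_power {..<r} (\<lambda>a b. Y a b \<omega>) m a b"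

abbreviation tr :: "nat \<Rightarrow> 'a \<Rightarrow> real" where
  "tr m \<omega> \<equiv> trace_power {..<r} (\<lambda>a b. Y a b \<omega>) m"

text \<open>\<open>F'\<close> plays the role of the gradient of \<open>F\<close>. Carrying an arbitrary monomial along makes
  the property stable under multiplication by entries.\<close>

definition stein :: "('a \<Rightarrow> real) \<Rightarrow> (nat \<Rightarrow> nat \<Rightarrow> 'a \<Rightarrow> real) \<Rightarrow> bool" where
  "stein F F' \<longleftrightarrow> (\<forall>L. set L \<subseteq> {..<r} \<times> {..<r} \<longrightarrow>
     integrable M (\<lambda>\<omega>. mon L \<omega> * F \<omega>) \<and>
     (\<forall>a<r. \<forall>b<r. integrable M (\<lambda>\<omega>. mon L \<omega> * F' a b \<omega>) \<and>
        expectation (\<lambda>\<omega>. mon ((a, b) # L) \<omega> * F \<omega>) =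
          (\<Sum>j<length L. goe_cov (a, b) (L ! j) * expectation (\<lambda>\<omega>. mon (del_nth j L) \<omega> * F \<omega>))
          + expectation (\<lambda>\<omega>. mon L \<omega> * F' a b \<omega>)))"

lemma steinD:
  assumes "stein F F'"
  shows "set L \<subseteq> {..<r} \<times> {..<r} \<Longrightarrow> integrable M (\<lambda>\<omega>. mon L \<omega> * F \<omega>)"
    and "set L \<subseteq> {..<r} \<times> {..<r} \<Longrightarrow> a < r \<Longrightarrow> b < r \<Longrightarrow> integrable M (\<lambda>\<omega>. mon L \<omega> * F' a b \<omega>)"
    and "set L \<subseteq> {..<r} \<times> {..<r} \<Longrightarrow> a < r \<Longrightarrow> b < r \<Longrightarrow> expectation (\<lambda>\<omega>. mon ((a, b) # L) \<omega> * F \<omega>) =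
          (\<Sum>j<length L. goe_cov (a, b) (L ! j) * expectation (\<lambda>\<omega>. mon (del_nth j L) \<omega> * F \<omega>))
          + expectation (\<lambda>\<omega>. mon L \<omega> * F' a b \<omega>)"
  using assms unfolding stein_def by blast+

lemma stein_integrable:
  assumes "stein F F'"
  shows "integrable M F" "a < r \<Longrightarrow> b < r \<Longrightarrow> integrable M (F' a b)"
    "a < r \<Longrightarrow> b < r \<Longrightarrow> integrable M (\<lambda>\<omega>. Y a b \<omega> * F \<omega>)"
    "a < r \<Longrightarrow> b < r \<Longrightarrow> expectation (\<lambda>\<omega>. Y a b \<omega> * F \<omega>) = expectation (F' a b)"
  using steinD[OF assms, of "[]"] steinD(1)[OF assms, of "[(a, b)]"] by simp_all

text \<open>The recursion of \<open>wick\<close> is itself integration by parts for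
  monomials.\<close>

lemma stein_one: "stein (\<lambda>_. 1) (\<lambda>_ _ _. 0)"
  unfolding stein_def
proof (intro allI impI conjI)
  fix L a b assume L: "set L \<subseteq> {..<r} \<times> {..<r}" and ab: "a < r" "b < r"
  have "set (del_nth j L) \<subseteq> {..<r} \<times> {..<r}" for j
    using L set_del_nth_subset[of j L] by blast
  then show "expectation (\<lambda>\<omega>. mon ((a, b) # L) \<omega> * 1) =
          (\<Sum>j<length L. goe_cov (a, b) (L ! j) * expectation (\<lambda>\<omega>. mon (del_nth j L) \<omega> * 1))
          + expectation (\<lambda>\<omega>. mon L \<omega> * 0)"
    using expectation_monomial[of "(a, b) # L"] L ab by (simp add: expectation_monomial)
qed (auto simp: integrable_monomial)

lemma stein_sum:
  assumes "finite S" and F: "\<And>c. c \<in> S \<Longrightarrow> stein (F c) (F' c)"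
  shows "stein (\<lambda>\<omega>. \<Sum>c\<in>S. F c \<omega>) (\<lambda>a b \<omega>. \<Sum>c\<in>S. F' c a b \<omega>)"
  unfolding stein_def
proof (intro allI impI conjI)
  fix L assume L: "set L \<subseteq> {..<r} \<times> {..<r}"
  show "integrable M (\<lambda>\<omega>. mon L \<omega> * (\<Sum>c\<in>S. F c \<omega>))"
    unfolding sum_distrib_left using steinD(1)[OF F L] by (intro Bochner_Integration.integrable_sum)
  fix a b assume ab: "a < r" "b < r"
  show "integrable M (\<lambda>\<omega>. mon L \<omega> * (\<Sum>c\<in>S. F' c a b \<omega>))"
    unfolding sum_distrib_left using steinD(2)[OF F L ab] by (intro Bochner_Integration.integrable_sum)
  have L': "set (del_nth j L) \<subseteq> {..<r} \<times> {..<r}" for j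
    using L set_del_nth_subset[of j L] by blast
  have L'': "set ((a, b) # L) \<subseteq> {..<r} \<times> {..<r}" using L ab by auto
  have "expectation (\<lambda>\<omega>. mon ((a, b) # L) \<omega> * (\<Sum>c\<in>S. F c \<omega>))
      = (\<Sum>c\<in>S. expectation (\<lambda>\<omega>. mon ((a, b) # L) \<omega> * F c \<omega>))"
    unfolding sum_distrib_left by (intro Bochner_Integration.integral_sum steinD(1)[OF F L''])
  also have "\<dots> = (\<Sum>c\<in>S. (\<Sum>j<length L. goe_cov (a, b) (L ! j) * expectation (\<lambda>\<omega>. mon (del_nth j L) \<omega> * F c \<omega>))
          + expectation (\<lambda>\<omega>. mon L \<omega> * F' c a b \<omega>))"
    by (intro sum.cong refl steinD(3)[OF F L ab])
  also have "\<dots> = (\<Sum>j<length L. goe_cov (a, b) (L ! j) * (\<Sum>c\<in>S. expectation (\<lambda>\<omega>. mon (del_nth j L) \<omega> * F c \<omega>)))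
          + (\<Sum>c\<in>S. expectation (\<lambda>\<omega>. mon L \<omega> * F' c a b \<omega>))"
    unfolding sum.distrib sum_distrib_left by (subst sum.swap) (rule refl)
  also have "(\<lambda>j. \<Sum>c\<in>S. expectation (\<lambda>\<omega>. mon (del_nth j L) \<omega> * F c \<omega>))
      = (\<lambda>j. expectation (\<lambda>\<omega>. mon (del_nth j L) \<omega> * (\<Sum>c\<in>S. F c \<omega>)))"
    unfolding sum_distrib_left
    by (intro ext Bochner_Integration.integral_sum[symmetric] steinD(1)[OF F L'])
  also have "(\<Sum>c\<in>S. expectation (\<lambda>\<omega>. mon L \<omega> * F' c a b \<omega>))
      = expectation (\<lambda>\<omega>. mon L \<omega> * (\<Sum>c\<in>S. F' c a b \<omega>))"
    unfolding sum_distrib_left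
    by (intro Bochner_Integration.integral_sum[symmetric] steinD(2)[OF F L ab])
  finally show "expectation (\<lambda>\<omega>. mon ((a, b) # L) \<omega> * (\<Sum>c\<in>S. F c \<omega>)) =
          (\<Sum>j<length L. goe_cov (a, b) (L ! j) * expectation (\<lambda>\<omega>. mon (del_nth j L) \<omega> * (\<Sum>c\<in>S. F c \<omega>)))
          + expectation (\<lambda>\<omega>. mon L \<omega> * (\<Sum>c\<in>S. F' c a b \<omega>))" .
qed

text \<open>The product rule. The new entry joins the monomial carried along, and its pairing with
  \<open>(a, b)\<close> is split off as the first term of the derivative.\<close>

lemma stein_entry:
  assumes F: "stein F F'" and cd: "c < r" "d < r"
  shows "stein (\<lambda>\<omega>. Y c d \<omega> * F \<omega>) (\<lambda>a b \<omega>. goe_cov (a, b) (c, d) * F \<omega> + Y c d \<omega> * F' a b \<omega>)"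
  unfolding stein_def
proof (intro allI impI conjI)
  fix L assume L: "set L \<subseteq> {..<r} \<times> {..<r}"
  then have L': "set ((c, d) # L) \<subseteq> {..<r} \<times> {..<r}" using cd by auto
  have eq: "mon L \<omega> * (Y c d \<omega> * G \<omega>) = mon ((c, d) # L) \<omega> * G \<omega>" for L \<omega> and G :: "'a \<Rightarrow> real"
    by simp
  show "integrable M (\<lambda>\<omega>. mon L \<omega> * (Y c d \<omega> * F \<omega>))"
    unfolding eq by (rule steinD(1)[OF F L'])
  fix a b assume ab: "a < r" "b < r"
  have i1: "integrable M (\<lambda>\<omega>. mon L \<omega> * (goe_cov (a, b) (c, d) * F \<omega>))"
    using steinD(1)[OF F L] by (simp add: mult.left_commute)
  have i2: "integrable M (\<lambda>\<omega>. mon L \<omega> * (Y c d \<omega> * F' a b \<omega>))"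
    unfolding eq by (rule steinD(2)[OF F L' ab])
  show "integrable M (\<lambda>\<omega>. mon L \<omega> * (goe_cov (a, b) (c, d) * F \<omega> + Y c d \<omega> * F' a b \<omega>))"
    unfolding distrib_left using i1 i2 by (rule Bochner_Integration.integrable_add)
  have "expectation (\<lambda>\<omega>. mon ((a, b) # L) \<omega> * (Y c d \<omega> * F \<omega>))
      = expectation (\<lambda>\<omega>. mon ((a, b) # (c, d) # L) \<omega> * F \<omega>)"
    by (simp add: mult_ac)
  also have "\<dots> = goe_cov (a, b) (c, d) * expectation (\<lambda>\<omega>. mon L \<omega> * F \<omega>)
      + (\<Sum>j<length L. goe_cov (a, b) (L ! j) * expectation (\<lambda>\<omega>. mon ((c, d) # del_nth j L) \<omega> * F \<omega>))
      + expectation (\<lambda>\<omega>. mon ((c, d) # L) \<omega> * F' a b \<omega>)"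
    unfolding steinD(3)[OF F L' ab] list.size(4) add_0_right add_Suc_right
    by (subst sum.lessThan_Suc_shift) simp
  also have "goe_cov (a, b) (c, d) * expectation (\<lambda>\<omega>. mon L \<omega> * F \<omega>)
      = expectation (\<lambda>\<omega>. mon L \<omega> * (goe_cov (a, b) (c, d) * F \<omega>))"
    by (simp add: mult.left_commute)
  finally show "expectation (\<lambda>\<omega>. mon ((a, b) # L) \<omega> * (Y c d \<omega> * F \<omega>)) =
          (\<Sum>j<length L. goe_cov (a, b) (L ! j) * expectation (\<lambda>\<omega>. mon (del_nth j L) \<omega> * (Y c d \<omega> * F \<omega>)))
          + expectation (\<lambda>\<omega>. mon L \<omega> * (goe_cov (a, b) (c, d) * F \<omega> + Y c d \<omega> * F' a b \<omega>))"
    unfolding distrib_left Bochner_Integration.integral_add[OF i1 i2] unfolding eq by simp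
qed

section \<open>Derivatives of matrix powers and traces, and the loop equation\<close>

text \<open>The derivative of the entry \<open>(c, d)\<close> of the power \<open>m\<close> in
  direction \<open>(a, b)\<close>: the factor at position \<open>s\<close> is removed, and the two
  parts of \<open>goe_cov\<close> reconnect the ends straight or with a twist.\<close>

definition dW :: "nat \<Rightarrow> nat \<Rightarrow> nat \<Rightarrow> nat \<Rightarrow> nat \<Rightarrow> 'a \<Rightarrow> real" where
  "dW m c d a b \<omega> = (\<Sum>s<m. W s c a \<omega> * W (m - 1 - s) b d \<omega> + W s c b \<omega> * W (m - 1 - s) a d \<omega>)"

lemma dW_Suc:
  assumes "a < r" "b < r"
  shows "(\<Sum>e<r. goe_cov (a, b) (c, e) * W m e d \<omega> + Y c e \<omega> * dW m e d a b \<omega>) = dW (Suc m) c d a b \<omega>"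
proof -
  have "(\<Sum>e<r. goe_cov (a, b) (c, e) * W m e d \<omega>)
      = (\<Sum>e<r. (if e = b then of_bool (a = c) * W m b d \<omega> else 0)) +
        (\<Sum>e<r. (if e = a then of_bool (b = c) * W m a d \<omega> else 0))"
    unfolding sum.distrib[symmetric] by (intro sum.cong) (auto simp: goe_cov_def)
  also have "\<dots> = W 0 c a \<omega> * W m b d \<omega> + W 0 c b \<omega> * W m a d \<omega>"
    using assms by (auto simp: sum.delta)
  finally have 1: "(\<Sum>e<r. goe_cov (a, b) (c, e) * W m e d \<omega>)
      = W 0 c a \<omega> * W m b d \<omega> + W 0 c b \<omega> * W m a d \<omega>" .
  have "(\<Sum>e<r. Y c e \<omega> * dW m e d a b \<omega>)
      = (\<Sum>s<m. \<Sum>e<r. Y c e \<omega> * (W s e a \<omega> * W (m - 1 - s) b d \<omega> + W s e b \<omega> * W (m - 1 - s) a d \<omega>))"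
    unfolding dW_def sum_distrib_left by (rule sum.swap)
  also have "\<dots> = (\<Sum>s<m. W (Suc s) c a \<omega> * W (m - 1 - s) b d \<omega> + W (Suc s) c b \<omega> * W (m - 1 - s) a d \<omega>)"
    by (simp add: distrib_left sum.distrib sum_distrib_right mult.assoc)
  finally have 2: "(\<Sum>e<r. Y c e \<omega> * dW m e d a b \<omega>)
      = (\<Sum>s<m. W (Suc s) c a \<omega> * W (m - 1 - s) b d \<omega> + W (Suc s) c b \<omega> * W (m - 1 - s) a d \<omega>)" .
  show ?thesis
    unfolding sum.distrib 1 2 unfolding dW_def
    by (subst sum.lessThan_Suc_shift) (simp del: mat_power.simps add: sum.distrib)
qed

lemma stein_mat_power:
  assumes F: "stein F F'" and d: "d < r"
  shows "c < r \<Longrightarrow> stein (\<lambda>\<omega>. W m c d \<omega> * F \<omega>) (\<lambda>a b \<omega>. dW m c d a b \<omega> * F \<omega> + W m c d \<omega> * F' a b \<omega>)"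
proof (induction m arbitrary: c)
  case 0
  show ?case
  proof (cases "c = d")
    case False
    \<comment> \<open>Off the diagonal the power 0 vanishes, and the zero function is obtained as an
      empty sum.\<close>
    then show ?thesis using stein_sum[of "{}" "\<lambda>_::nat. F" "\<lambda>_. F'"] by (simp add: dW_def)
  qed (use F in \<open>simp add: dW_def\<close>)
next
  case (Suc m)
  have *: "stein (\<lambda>\<omega>. \<Sum>e<r. Y c e \<omega> * (W m e d \<omega> * F \<omega>))
     (\<lambda>a b \<omega>. \<Sum>e<r. goe_cov (a, b) (c, e) * (W m e d \<omega> * F \<omega>)
         + Y c e \<omega> * (dW m e d a b \<omega> * F \<omega> + W m e d \<omega> * F' a b \<omega>))"
    using Suc by (intro stein_sum stein_entry) auto
  have "(\<Sum>e<r. goe_cov (a, b) (c, e) * (W m e d \<omega> * F \<omega>)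
         + Y c e \<omega> * (dW m e d a b \<omega> * F \<omega> + W m e d \<omega> * F' a b \<omega>))
      = dW (Suc m) c d a b \<omega> * F \<omega> + W (Suc m) c d \<omega> * F' a b \<omega>" if "a < r" "b < r" for a b \<omega>
    unfolding dW_Suc[OF that, symmetric] mat_power.simps sum_distrib_right sum.distrib[symmetric]
    by (simp add: algebra_simps)
  moreover have "(\<Sum>e<r. Y c e \<omega> * (W m e d \<omega> * F \<omega>)) = W (Suc m) c d \<omega> * F \<omega>" for \<omega>
    by (simp add: sum_distrib_right mult.assoc)
  ultimately show ?case using * unfolding stein_def by (simp del: mat_power.simps)
qed

text \<open>After closing up into a trace all \<open>m\<close> positions of the removed factor are
  equivalent, and the symmetry of Y identifies the two reconnections.\<close>

lemma sum_dW_trace: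
  assumes "a < r" "b < r"
  shows "(\<Sum>c<r. dW m c c a b \<omega>) = 2 * real m * W (m - 1) a b \<omega>"
proof -
  have W_sym: "W k u v \<omega> = W k v u \<omega>" if "u < r" "v < r" for k u v
    using mat_power_sym[of "{..<r}" "\<lambda>a b. Y a b \<omega>"] Y_sym that by simp
  have "(\<Sum>c<r. dW m c c a b \<omega>)
     = (\<Sum>s<m. (\<Sum>c<r. W (m - 1 - s) b c \<omega> * W s c a \<omega>) + (\<Sum>c<r. W (m - 1 - s) a c \<omega> * W s c b \<omega>))"
    unfolding dW_def sum.distrib[symmetric] by (subst sum.swap) (simp add: mult.commute)
  also have "\<dots> = (\<Sum>s<m. W (m - 1) b a \<omega> + W (m - 1) a b \<omega>)"
    using assms by (intro sum.cong refl) (simp add: mat_power_add[symmetric])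
  also have "\<dots> = 2 * real m * W (m - 1) a b \<omega>"
    using W_sym[OF assms] by simp
  finally show ?thesis .
qed

lemma stein_trace:
  assumes F: "stein F F'"
  shows "stein (\<lambda>\<omega>. tr m \<omega> * F \<omega>) (\<lambda>a b \<omega>. 2 * real m * W (m - 1) a b \<omega> * F \<omega> + tr m \<omega> * F' a b \<omega>)"
proof -
  have *: "stein (\<lambda>\<omega>. \<Sum>c<r. W m c c \<omega> * F \<omega>) (\<lambda>a b \<omega>. \<Sum>c<r. dW m c c a b \<omega> * F \<omega> + W m c c \<omega> * F' a b \<omega>)"
    by (intro stein_sum stein_mat_power F) auto
  have "(\<Sum>c<r. dW m c c a b \<omega> * F \<omega> + W m c c \<omega> * F' a b \<omega>)
     = 2 * real m * W (m - 1) a b \<omega> * F \<omega> + tr m \<omega> * F' a b \<omega>" if "a < r" "b < r" for a b \<omega>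
    unfolding sum_dW_trace[OF that, symmetric] trace_power_def by (simp add: sum.distrib sum_distrib_right)
  moreover have "(\<Sum>c<r. W m c c \<omega> * F \<omega>) = tr m \<omega> * F \<omega>" for \<omega>
    by (simp add: trace_power_def sum_distrib_right)
  ultimately show ?thesis using * unfolding stein_def by simp
qed

abbreviation trs :: "nat list \<Rightarrow> 'a \<Rightarrow> real" where
  "trs ns \<omega> \<equiv> (\<Prod>n\<leftarrow>ns. tr n \<omega>)"

lemma stein_traces:
  "stein (trs ns) (\<lambda>a b \<omega>. \<Sum>j<length ns. 2 * real (ns ! j) * W (ns ! j - 1) a b \<omega> * trs (del_nth j ns) \<omega>)"
proof (induction ns)
  case Nil
  then show ?case using stein_one by simp
next
  case (Cons n ns)
  have eq: "2 * real n * W (n - 1) a b \<omega> * trs ns \<omega> +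
     tr n \<omega> * (\<Sum>j<length ns. 2 * real (ns ! j) * W (ns ! j - 1) a b \<omega> * trs (del_nth j ns) \<omega>)
    = (\<Sum>j<length (n # ns). 2 * real ((n # ns) ! j) * W ((n # ns) ! j - 1) a b \<omega> * trs (del_nth j (n # ns)) \<omega>)"
    for a b \<omega>
    unfolding list.size(4) add_0_right add_Suc_right
    by (subst sum.lessThan_Suc_shift) (simp add: sum_distrib_left mult_ac)
  show ?case using stein_trace[OF Cons.IH, of n] unfolding eq by simp
qed

definition T :: "nat list \<Rightarrow> real" where "T ns = expectation (trs ns)"

lemma integrable_trs: "integrable M (trs ns)"
  using stein_integrable(1)[OF stein_traces] .

text \<open>One factor is pulled out of the first trace and integrated by parts. If its partner lies
  in the same trace, a straight reconnection splits that trace into two and a twisted one leaves a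
  single trace, once for each of \<open>m\<close> positions. If the partner lies in another trace,
  the two merge.\<close>

lemma loop_equation:
  "T (Suc m # ns) = (\<Sum>s<m. T (s # (m - 1 - s) # ns)) + real m * T ((m - 1) # ns)
     + (\<Sum>j<length ns. 2 * real (ns ! j) * T ((m + ns ! j - 1) # del_nth j ns))"
proof -
  let ?R' = "\<lambda>a b \<omega>. \<Sum>j<length ns. 2 * real (ns ! j) * W (ns ! j - 1) a b \<omega> * trs (del_nth j ns) \<omega>"
  have i: "stein (\<lambda>\<omega>. W m b a \<omega> * trs ns \<omega>) (\<lambda>a' b' \<omega>. dW m b a a' b' \<omega> * trs ns \<omega> + W m b a \<omega> * ?R' a' b' \<omega>)"
    if "a < r" "b < r" for a b
    using stein_mat_power[OF stein_traces that] .
  have W_sym: "W k u v \<omega> = W k v u \<omega>" if "u < r" "v < r" for k u v \<omega>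
    using mat_power_sym[of "{..<r}" "\<lambda>a b. Y a b \<omega>"] Y_sym that by simp
  have "T (Suc m # ns) = expectation (\<lambda>\<omega>. \<Sum>a<r. \<Sum>b<r. Y a b \<omega> * (W m b a \<omega> * trs ns \<omega>))"
    by (simp add: T_def trace_power_def sum_distrib_right mult.assoc)
  also have "\<dots> = (\<Sum>a<r. \<Sum>b<r. expectation (\<lambda>\<omega>. Y a b \<omega> * (W m b a \<omega> * trs ns \<omega>)))"
    by (intro integral_sum_sum stein_integrable(3)[OF i]) auto
  also have "\<dots> = (\<Sum>a<r. \<Sum>b<r. expectation (\<lambda>\<omega>. dW m b a a b \<omega> * trs ns \<omega> + W m b a \<omega> * ?R' a b \<omega>))"
    using stein_integrable(4)[OF i] by simp
  also have "\<dots> = expectation (\<lambda>\<omega>. \<Sum>a<r. \<Sum>b<r. dW m b a a b \<omega> * trs ns \<omega> + W m b a \<omega> * ?R' a b \<omega>)"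
    by (intro integral_sum_sum[symmetric] stein_integrable(2)[OF i]) auto
  also have "\<dots> = expectation (\<lambda>\<omega>. (\<Sum>s<m. trs (s # (m - 1 - s) # ns) \<omega>) + real m * trs ((m - 1) # ns) \<omega>
     + (\<Sum>j<length ns. 2 * real (ns ! j) * trs ((m + ns ! j - 1) # del_nth j ns) \<omega>))"
  proof (intro Bochner_Integration.integral_cong refl)
    fix \<omega>
    have "(\<Sum>a<r. \<Sum>b<r. dW m b a a b \<omega>)
       = (\<Sum>s<m. \<Sum>a<r. \<Sum>b<r. W s b a \<omega> * W (m - 1 - s) b a \<omega> + W s b b \<omega> * W (m - 1 - s) a a \<omega>)"
      unfolding dW_def by (subst (2) sum.swap) (subst sum.swap, rule refl)
    also have "\<dots> = (\<Sum>s<m. tr (m - 1) \<omega> + tr s \<omega> * tr (m - 1 - s) \<omega>)"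
    proof (intro sum.cong refl)
      fix s assume "s \<in> {..<m}"
      then have s: "m - 1 = s + (m - 1 - s)" by auto
      have "(\<Sum>a<r. \<Sum>b<r. W s b a \<omega> * W (m - 1 - s) b a \<omega>) = (\<Sum>a<r. W (s + (m - 1 - s)) a a \<omega>)"
        by (auto intro!: sum.cong simp: mat_power_add W_sym)
      moreover have "(\<Sum>a<r. \<Sum>b<r. W s b b \<omega> * W (m - 1 - s) a a \<omega>) = tr s \<omega> * tr (m - 1 - s) \<omega>"
        unfolding trace_power_def sum_product by (rule sum.swap)
      ultimately show "(\<Sum>a<r. \<Sum>b<r. W s b a \<omega> * W (m - 1 - s) b a \<omega> + W s b b \<omega> * W (m - 1 - s) a a \<omega>)
         = tr (m - 1) \<omega> + tr s \<omega> * tr (m - 1 - s) \<omega>"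
        using s by (simp add: sum.distrib trace_power_def)
    qed
    finally have 1: "(\<Sum>a<r. \<Sum>b<r. dW m b a a b \<omega>) = (\<Sum>s<m. tr (m - 1) \<omega> + tr s \<omega> * tr (m - 1 - s) \<omega>)" .
    have "(\<Sum>a<r. \<Sum>b<r. W m b a \<omega> * ?R' a b \<omega>)
       = (\<Sum>j<length ns. \<Sum>a<r. \<Sum>b<r. W m b a \<omega> * (2 * real (ns ! j) * W (ns ! j - 1) a b \<omega> * trs (del_nth j ns) \<omega>))"
      unfolding sum_distrib_left by (subst (2) sum.swap) (subst sum.swap, rule refl)
    also have "\<dots> = (\<Sum>j<length ns. 2 * real (ns ! j) * trs ((m + ns ! j - 1) # del_nth j ns) \<omega>)"
    proof (intro sum.cong refl)
      fix j
      have "(\<Sum>a<r. \<Sum>b<r. W (ns ! j - 1) a b \<omega> * W m b a \<omega>) = tr (ns ! j - 1 + m) \<omega>"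
        by (simp add: trace_power_def mat_power_add)
      \<comment> \<open>For \<open>ns ! j = 0\<close> the truncated exponents can differ, but then
        the coefficient is zero.\<close>
      moreover have "real (ns ! j) * tr (ns ! j - 1 + m) \<omega> = real (ns ! j) * tr (m + ns ! j - 1) \<omega>"
        by (cases "ns ! j") (auto simp: add.commute)
      moreover have "(\<Sum>a<r. \<Sum>b<r. W m b a \<omega> * (2 * real (ns ! j) * W (ns ! j - 1) a b \<omega> * trs (del_nth j ns) \<omega>))
          = 2 * real (ns ! j) * (\<Sum>a<r. \<Sum>b<r. W (ns ! j - 1) a b \<omega> * W m b a \<omega>) * trs (del_nth j ns) \<omega>"
        by (simp add: sum_distrib_left sum_distrib_right mult_ac)
      ultimately show "(\<Sum>a<r. \<Sum>b<r. W m b a \<omega> * (2 * real (ns ! j) * W (ns ! j - 1) a b \<omega> * trs (del_nth j ns) \<omega>))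
          = 2 * real (ns ! j) * trs ((m + ns ! j - 1) # del_nth j ns) \<omega>"
        by auto
    qed
    finally have 2: "(\<Sum>a<r. \<Sum>b<r. W m b a \<omega> * ?R' a b \<omega>)
        = (\<Sum>j<length ns. 2 * real (ns ! j) * trs ((m + ns ! j - 1) # del_nth j ns) \<omega>)" .
    show "(\<Sum>a<r. \<Sum>b<r. dW m b a a b \<omega> * trs ns \<omega> + W m b a \<omega> * ?R' a b \<omega>)
      = (\<Sum>s<m. trs (s # (m - 1 - s) # ns) \<omega>) + real m * trs ((m - 1) # ns) \<omega>
     + (\<Sum>j<length ns. 2 * real (ns ! j) * trs ((m + ns ! j - 1) # del_nth j ns) \<omega>)"
      unfolding sum.distrib 2 sum_distrib_right[symmetric] 1
      by (simp add: distrib_right sum_distrib_right mult.assoc)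
  qed
  also have "\<dots> = (\<Sum>s<m. T (s # (m - 1 - s) # ns)) + real m * T ((m - 1) # ns)
     + (\<Sum>j<length ns. 2 * real (ns ! j) * T ((m + ns ! j - 1) # del_nth j ns))"
    unfolding T_def
    using integrable_trs[of "s # (m - 1 - s) # ns" for s] integrable_trs[of "(m - 1) # ns"]
      integrable_trs[of "(m + ns ! j - 1) # del_nth j ns" for j]
    by (simp add: Bochner_Integration.integral_add Bochner_Integration.integral_sum
        Bochner_Integration.integrable_sum Bochner_Integration.integrable_add del: list.map prod_list.Cons)
  finally show ?thesis .
qed

end

section \<open>Shape comparison of closed walks\<close>

definition edges :: "'i list \<Rightarrow> ('i \<times> 'i) list" where "edges w = zip w (tl w)"

lemma edges_Cons: "w \<noteq> [] \<Longrightarrow> edges (a # w) = (a, hd w) # edges w"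
  by (cases w) (auto simp: edges_def)

lemma edges_map: "edges (map f w) = map (map_prod f f) (edges w)"
  by (induction w rule: induct_list012) (auto simp: edges_def)

lemma length_edges: "length (edges w) = length w - 1"
  by (simp add: edges_def)

lemma set_edges_subset: "set (edges w) \<subseteq> set w \<times> set w"
proof
  fix e assume e: "e \<in> set (edges w)"
  obtain a c where ac: "e = (a, c)" by (cases e)
  have "a \<in> set w" "c \<in> set (tl w)"
    using e unfolding edges_def ac by (rule set_zip_leftD, rule set_zip_rightD)
  moreover have "set (tl w) \<subseteq> set w" by (cases w) auto
  ultimately show "e \<in> set w \<times> set w" using ac by blast
qed

lemma set_edges_conv: "set (edges w) = {(w ! (k - 1), w ! k) |k. 0 < k \<and> k < length w}"
proof -
  have "set (edges w) = {(w ! k, tl w ! k) |k. k < length w - 1}"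
    by (auto simp: edges_def set_zip)
  also have "\<dots> = {(w ! (k - 1), w ! k) |k. 0 < k \<and> k < length w}"
  proof (intro equalityI subsetI)
    fix e assume "e \<in> {(w ! k, tl w ! k) |k. k < length w - 1}"
    then obtain k where "e = (w ! k, tl w ! k)" "k < length w - 1" by auto
    then show "e \<in> {(w ! (k - 1), w ! k) |k. 0 < k \<and> k < length w}"
      by (intro CollectI exI[of _ "Suc k"]) (auto simp: nth_tl)
  next
    fix e assume "e \<in> {(w ! (k - 1), w ! k) |k. 0 < k \<and> k < length w}"
    then obtain k where "e = (w ! (k - 1), w ! k)" "0 < k" "k < length w" by auto
    then show "e \<in> {(w ! k, tl w ! k) |k. k < length w - 1}"
      by (intro CollectI exI[of _ "k - 1"]) (auto simp: nth_tl)
  qed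
  finally show ?thesis .
qed

section \<open>Traces as sums over closed walks\<close>

definition closed_walks :: "'i set \<Rightarrow> nat \<Rightarrow> 'i list set" where
  "closed_walks I m = {w. set w \<subseteq> I \<and> length w = Suc m \<and> hd w = last w}"

lemma finite_closed_walks: "finite I \<Longrightarrow> finite (closed_walks I m)"
  by (rule finite_subset[OF _ finite_lists_length_eq[of I "Suc m"]]) (auto simp: closed_walks_def)

lemma mat_power_eq_sum_walks:
  assumes "finite I" "a \<in> I" "b \<in> I"
  shows "mat_power I A m a b = (\<Sum>w | set w \<subseteq> I \<and> length w = Suc m \<and> hd w = a \<and> last w = b. \<Prod>e\<leftarrow>edges w. A (fst e) (snd e))"
  using assms(2)
proof (induction m arbitrary: a)
  case 0
  have "{w. set w \<subseteq> I \<and> length w = Suc 0 \<and> hd w = a \<and> last w = b} = (if a = b then {[a]} else {})"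
    using 0 by (auto simp: length_Suc_conv)
  then show ?case by (auto simp: edges_def)
next
  case (Suc m)
  let ?V = "\<lambda>m a. {w. set w \<subseteq> I \<and> length w = Suc m \<and> hd w = a \<and> last w = b}"
  have fin: "finite (?V m a)" for m a
    by (rule finite_subset[OF _ finite_lists_length_eq[OF assms(1), of "Suc m"]]) auto
  have eq: "?V (Suc m) a = (#) a ` (\<Union>c\<in>I. ?V m c)"
  proof (intro equalityI subsetI)
    fix w assume w: "w \<in> ?V (Suc m) a"
    then obtain w' where w': "w = a # w'" "length w' = Suc m" by (cases w) auto
    then have "w' \<noteq> []" by auto
    then have "w' \<in> ?V m (hd w')" "hd w' \<in> I" using w w' by (auto simp: hd_in_set subset_iff)
    then show "w \<in> (#) a ` (\<Union>c\<in>I. ?V m c)" using w' by blast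
  qed (use Suc.prems in \<open>auto split: if_splits\<close>)
  have "(\<Sum>w\<in>?V (Suc m) a. \<Prod>e\<leftarrow>edges w. A (fst e) (snd e))
      = (\<Sum>w\<in>(\<Union>c\<in>I. ?V m c). \<Prod>e\<leftarrow>edges (a # w). A (fst e) (snd e))"
    unfolding eq by (subst sum.reindex) auto
  also have "\<dots> = (\<Sum>c\<in>I. \<Sum>w\<in>?V m c. \<Prod>e\<leftarrow>edges (a # w). A (fst e) (snd e))"
    using assms(1) fin by (intro sum.UNION_disjoint) auto
  also have "\<dots> = (\<Sum>c\<in>I. \<Sum>w\<in>?V m c. A a c * (\<Prod>e\<leftarrow>edges w. A (fst e) (snd e)))"
  proof (intro sum.cong refl)
    fix c w assume "w \<in> ?V m c"
    then have "w \<noteq> []" "hd w = c" by auto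
    then show "(\<Prod>e\<leftarrow>edges (a # w). A (fst e) (snd e)) = A a c * (\<Prod>e\<leftarrow>edges w. A (fst e) (snd e))"
      by (simp add: edges_Cons)
  qed
  finally show ?case using Suc.IH by (simp add: sum_distrib_left)
qed

lemma trace_power_eq_sum_closed_walks:
  assumes "finite I"
  shows "trace_power I A m = (\<Sum>w\<in>closed_walks I m. \<Prod>e\<leftarrow>edges w. A (fst e) (snd e))"
proof -
  let ?V = "\<lambda>a. {w. set w \<subseteq> I \<and> length w = Suc m \<and> hd w = a \<and> last w = a}"
  have fin: "finite (?V a)" for a
    by (rule finite_subset[OF _ finite_lists_length_eq[OF assms, of "Suc m"]]) auto
  have "closed_walks I m = (\<Union>a\<in>I. ?V a)"
  proof (intro equalityI subsetI)
    fix w assume w: "w \<in> closed_walks I m"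
    then have "w \<noteq> []" by (auto simp: closed_walks_def)
    then have "hd w \<in> I" using w by (auto simp: closed_walks_def)
    then show "w \<in> (\<Union>a\<in>I. ?V a)" using w by (auto simp: closed_walks_def)
  qed (auto simp: closed_walks_def)
  then have "(\<Sum>w\<in>closed_walks I m. \<Prod>e\<leftarrow>edges w. A (fst e) (snd e)) = (\<Sum>a\<in>I. \<Sum>w\<in>?V a. \<Prod>e\<leftarrow>edges w. A (fst e) (snd e))"
    using assms fin by (simp only:) (intro sum.UNION_disjoint, auto)
  then show ?thesis using assms by (simp add: trace_power_def mat_power_eq_sum_walks)
qed

section \<open>Shapes of words\<close>

definition first_index :: "'i list \<Rightarrow> 'i \<Rightarrow> nat" where
  "first_index w a = length (takeWhile (\<lambda>x. x \<noteq> a) w)"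

text \<open>The pattern of a word is a word in positions with the same coincidences between letters, so
  it is a canonical representative of its shape.\<close>

definition pattern :: "'i list \<Rightarrow> nat list" where "pattern w = map (first_index w) w"

lemma first_index_less: "a \<in> set w \<Longrightarrow> first_index w a < length w"
  by (induction w) (auto simp: first_index_def)

lemma nth_first_index: "a \<in> set w \<Longrightarrow> w ! first_index w a = a"
  using nth_length_takeWhile[OF first_index_less[unfolded first_index_def], of a w] by (simp add: first_index_def)

lemma inj_on_first_index: "inj_on (first_index w) (set w)"
  by (metis inj_onI nth_first_index)

lemma length_pattern [simp]: "length (pattern w) = length w"
  by (simp add: pattern_def)

lemma pattern_Nil [simp]: "pattern [] = []"
  by (simp add: pattern_def)

lemma pattern_Nil_iff [simp]: "pattern w = [] \<longleftrightarrow> w = []"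
  by (simp add: pattern_def)

lemma card_set_pattern: "card (set (pattern w)) = card (set w)"
  by (simp add: pattern_def card_image inj_on_first_index)

lemma pattern_snoc: "pattern (w @ [b]) = pattern w @ [if b \<in> set w then first_index w b else length w]"
proof -
  have "first_index (w @ [b]) a = first_index w a" if "a \<in> set w" for a
    using that takeWhile_append1[of a w "\<lambda>x. x \<noteq> a" "[b]"] by (simp add: first_index_def)
  moreover have "first_index (w @ [b]) b = length w" if "b \<notin> set w"
    unfolding first_index_def using that by (subst takeWhile_append2) auto
  ultimately show ?thesis by (auto simp: pattern_def)
qed

lemma set_pat_subset: "set (pattern w) \<subseteq> {..<length w}"
  by (auto simp: pattern_def first_index_less)

definition words :: "'i set \<Rightarrow> nat list \<Rightarrow> 'i list set" where
  "words I \<pi> = {w. set w \<subseteq> I \<and> pattern w = \<pi>}"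

lemma finite_words: "finite I \<Longrightarrow> finite (words I \<pi>)"
  by (rule finite_subset[OF _ finite_lists_length_eq[of I "length \<pi>"]]) (auto simp: words_def)

text \<open>Pattern letters are first positions, so a last letter equal to its own position
  \<open>length \<pi>\<close> means exactly that the walk enters a new vertex.\<close>

lemma words_snoc_new:
  assumes "\<pi> \<noteq> []"
  shows "words I (\<pi> @ [length \<pi>]) = (\<lambda>(w, b). w @ [b]) ` (SIGMA w:words I \<pi>. I - set w)"
proof (intro equalityI subsetI)
  fix v assume v: "v \<in> words I (\<pi> @ [length \<pi>])"
  then have "pattern v = \<pi> @ [length \<pi>]" by (simp add: words_def)
  then have "v \<noteq> []" by auto
  then obtain w b where wb: "v = w @ [b]" by (metis rev_exhaust)
  have "pattern w = \<pi>" "(if b \<in> set w then first_index w b else length w) = length \<pi>"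
    using v by (auto simp: words_def wb pattern_snoc)
  moreover from this have "b \<notin> set w" using first_index_less[of b w] by (auto split: if_splits)
  ultimately show "v \<in> (\<lambda>(w, b). w @ [b]) ` (SIGMA w:words I \<pi>. I - set w)"
    using v by (auto simp: words_def wb intro!: image_eqI[of _ _ "(w, b)"])
qed (auto simp: words_def pattern_snoc)

text \<open>The appended vertex is determined by the earlier ones. Only an inclusion, because the
  left side is empty when \<open>j\<close> is not the first position of a letter.\<close>

lemma words_snoc_old:
  assumes "\<pi> \<noteq> []" "j \<noteq> length \<pi>"
  shows "words I (\<pi> @ [j]) \<subseteq> (\<lambda>w. w @ [w ! j]) ` {w \<in> words I \<pi>. w ! j \<in> set w}"
proof
  fix v assume v: "v \<in> words I (\<pi> @ [j])"
  then have "pattern v = \<pi> @ [j]" by (simp add: words_def)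
  then have "v \<noteq> []" by auto
  then obtain w b where wb: "v = w @ [b]" by (metis rev_exhaust)
  have *: "pattern w = \<pi>" "(if b \<in> set w then first_index w b else length w) = j"
    using v by (auto simp: words_def wb pattern_snoc)
  then have b: "b \<in> set w" using assms by (auto split: if_splits)
  then have "b = w ! j" using * nth_first_index[of b w] by auto
  then show "v \<in> (\<lambda>w. w @ [w ! j]) ` {w \<in> words I \<pi>. w ! j \<in> set w}"
    using v * b by (auto simp: words_def wb)
qed

section \<open>Unordered edges and spanning trees of walks\<close>

text \<open>Represents an unordered edge by its copy in the lower triangle, where the independent
  entries are indexed.\<close>

definition canonical_edge :: "'i::linorder \<times> 'i \<Rightarrow> 'i \<times> 'i" where
  "canonical_edge e = (max (fst e) (snd e), min (fst e) (snd e))"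

lemma canonical_edge_eq_iff: "canonical_edge e = canonical_edge f \<longleftrightarrow> fst e = fst f \<and> snd e = snd f \<or> fst e = snd f \<and> snd e = fst f"
proof -
  obtain a b c d where ef: "e = (a, b)" "f = (c, d)" by (cases e, cases f)
  have canonical_edge: "canonical_edge (a, b) = (if a \<le> b then (b, a) else (a, b))" for a b :: 'a
    by (simp add: canonical_edge_def max_def min_def)
  show ?thesis unfolding ef canonical_edge fst_conv snd_conv
    by (cases "a \<le> b"; cases "c \<le> d") (simp_all, (metis nle_le)+)
qed
lemma goe_cov_eq_0_iff: "goe_cov e f = 0 \<longleftrightarrow> canonical_edge e \<noteq> canonical_edge f"
  unfolding canonical_edge_eq_iff goe_cov_def by (simp only: of_bool_def split: if_split) linarith
text \<open>The two sides differ only at loops, where \<open>goe_cov\<close> is 2. By monotonicity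
  of \<open>wick\<close>, the pairing sums of standard entries are dominated by those of the
  orthogonal ensemble.\<close>

lemma of_bool_can_le_goe_cov: "of_bool (canonical_edge e = canonical_edge f) \<le> goe_cov e f"
  unfolding canonical_edge_eq_iff goe_cov_def by (simp only: of_bool_def split: if_split) linarith

text \<open>The edges along which a walk discovers a new vertex form a spanning tree of its graph.\<close>

definition tree_edges :: "'i::linorder list \<Rightarrow> ('i \<times> 'i) set" where
  "tree_edges w = (\<lambda>k. canonical_edge (w ! (k - 1), w ! k)) ` {k. 0 < k \<and> k < length w \<and> w ! k \<notin> set (take k w)}"

lemma tree_edges_subset: "tree_edges w \<subseteq> canonical_edge ` set (edges w)"
  unfolding tree_edges_def set_edges_conv by auto

lemma tree_edges_singleton [simp]: "tree_edges [a] = {}"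
  by (auto simp: tree_edges_def)

lemma tree_edges_snoc:
  assumes "w \<noteq> []"
  shows "tree_edges (w @ [c]) = tree_edges w \<union> (if c \<in> set w then {} else {canonical_edge (last w, c)})"
proof -
  have "{k. 0 < k \<and> k < length (w @ [c]) \<and> (w @ [c]) ! k \<notin> set (take k (w @ [c]))}
      = {k. 0 < k \<and> k < length w \<and> w ! k \<notin> set (take k w)} \<union> (if c \<in> set w then {} else {length w})"
    using assms by (auto simp: nth_append less_Suc_eq)
  moreover have "(\<lambda>k. canonical_edge ((w @ [c]) ! (k - 1), (w @ [c]) ! k)) ` {k. 0 < k \<and> k < length w \<and> w ! k \<notin> set (take k w)}
      = tree_edges w"
    unfolding tree_edges_def by (intro image_cong refl) (auto simp: nth_append)
  moreover have "canonical_edge ((w @ [c]) ! (length w - 1), (w @ [c]) ! length w) = canonical_edge (last w, c)"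
    using assms by (simp add: nth_append last_conv_nth)
  ultimately show ?thesis unfolding tree_edges_def[of "w @ [c]"] by (simp add: image_Un)
qed

lemma canonical_edge_new_notin:
  assumes "c \<notin> set w"
  shows "canonical_edge (a, c) \<notin> tree_edges w"
proof
  assume "canonical_edge (a, c) \<in> tree_edges w"
  then obtain e where e: "e \<in> set (edges w)" "canonical_edge (a, c) = canonical_edge e" using tree_edges_subset by blast
  then have "c = fst e \<or> c = snd e" by (auto simp: canonical_edge_eq_iff)
  moreover have "e \<in> set w \<times> set w" using e(1) set_edges_subset[of w] by blast
  ultimately show False using assms by (metis mem_Times_iff)
qed

lemma finite_tree_edges [simp]: "finite (tree_edges w)"
  unfolding tree_edges_def by simp

text \<open>Every vertex after the first contributes one edge, and it differs from the earlier ones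
  because it contains a vertex that they do not.\<close>

lemma card_tree_edges: "w \<noteq> [] \<Longrightarrow> Suc (card (tree_edges w)) = card (set w)"
proof (induction w rule: rev_nonempty_induct)
  case (snoc c w)
  then show ?case by (auto simp: tree_edges_snoc canonical_edge_new_notin insert_absorb)
qed simp

section \<open>Upper and lower counts of the words of a given shape\<close>

text \<open>The word is built letter by letter. The start has \<open>card I\<close> choices; a new
  vertex adds one tree edge at the current endpoint, and summing it out costs at most a row sum
  \<open>s\<close>; an old vertex leaves no choice and adds no tree edge.\<close>

lemma sum_words_le:
  fixes \<beta> :: "'i::linorder \<times> 'i \<Rightarrow> real"
  assumes fin: "finite I" and \<beta>0: "\<And>e. 0 \<le> \<beta> e" and s: "\<And>a. a \<in> I \<Longrightarrow> (\<Sum>c\<in>I. \<beta> (canonical_edge (a, c))) \<le> s"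
    and "\<pi> \<noteq> []"
  shows "(\<Sum>w\<in>words I \<pi>. \<Prod>e\<in>tree_edges w. \<beta> e) \<le> real (card I) * s ^ (card (set \<pi>) - 1)"
  using \<open>\<pi> \<noteq> []\<close>
proof (induction \<pi> rule: rev_nonempty_induct)
  case (single j)
  have "words I [j] \<subseteq> (\<lambda>a. [a]) ` I"
  proof
    fix w assume "w \<in> words I [j]"
    then have "set w \<subseteq> I" "length w = 1" by (auto simp: words_def dest: arg_cong[of _ _ length])
    then show "w \<in> (\<lambda>a. [a]) ` I" by (cases w) auto
  qed
  then have "(\<Sum>w\<in>words I [j]. \<Prod>e\<in>tree_edges w. \<beta> e) \<le> (\<Sum>w\<in>(\<lambda>a. [a]) ` I. \<Prod>e\<in>tree_edges w. \<beta> e)"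
    using fin \<beta>0 by (intro sum_mono2) (auto intro: prod_nonneg)
  also have "\<dots> = real (card I)" by (subst sum.reindex) (auto simp: inj_on_def)
  finally show ?case by simp
next
  case (snoc j \<pi>)
  let ?t = "\<lambda>w. \<Prod>e\<in>tree_edges w. \<beta> e"
  have t0: "0 \<le> ?t w" for w using \<beta>0 by (intro prod_nonneg) auto
  have s0: "0 \<le> s" if ne: "I \<noteq> {}"
  proof -
    obtain a where "a \<in> I" using ne by blast
    then show ?thesis using s[of a] sum_nonneg[of I "\<lambda>c. \<beta> (canonical_edge (a, c))"] \<beta>0 by simp
  qed
  \<comment> \<open>If no word has this pattern only nonnegativity of the bound is claimed;
    otherwise a witness shows that \<pi> is itself a pattern.\<close>
  show ?case
  proof (cases "words I (\<pi> @ [j]) = {}")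
    case True
    then show ?thesis using s0 by (cases "I = {}") auto
  next
    case ne: False
    then obtain v where "v \<in> words I (\<pi> @ [j])" by blast
    then have "words I \<pi> \<noteq> {}"
      using words_snoc_old[OF snoc.hyps, of j I] words_snoc_new[OF snoc.hyps, of I]
      by (cases "j = length \<pi>") auto
    then obtain w where "w \<in> words I \<pi>" by blast
    then have sub: "set \<pi> \<subseteq> {..<length \<pi>}" using set_pat_subset[of w] by (auto simp: words_def)
    have s0': "0 \<le> s"
    proof -
      have "I \<noteq> {}" using \<open>v \<in> words I (\<pi> @ [j])\<close> by (auto simp: words_def)
      then show ?thesis using s0 by simp
    qed
    show ?thesis
    proof (cases "j = length \<pi>")
      case True
      have "(\<Sum>w\<in>words I (\<pi> @ [j]). ?t w) = (\<Sum>(w, b)\<in>(SIGMA w:words I \<pi>. I - set w). ?t (w @ [b]))"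
        unfolding True words_snoc_new[OF snoc.hyps]
        by (subst sum.reindex) (auto simp: inj_on_def case_prod_beta)
      also have "\<dots> = (\<Sum>w\<in>words I \<pi>. \<Sum>b\<in>I - set w. ?t (w @ [b]))"
        using fin by (subst sum.Sigma) (auto simp: finite_words)
      also have "\<dots> \<le> (\<Sum>w\<in>words I \<pi>. ?t w * s)"
      proof (intro sum_mono)
        fix w assume w: "w \<in> words I \<pi>"
        then have wne: "w \<noteq> []" using snoc.hyps by (auto simp: words_def)
        have "(\<Sum>b\<in>I - set w. ?t (w @ [b])) = (\<Sum>b\<in>I - set w. ?t w * \<beta> (canonical_edge (last w, b)))"
          using wne by (intro sum.cong refl) (auto simp: tree_edges_snoc canonical_edge_new_notin mult.commute)
        also have "\<dots> = ?t w * (\<Sum>b\<in>I - set w. \<beta> (canonical_edge (last w, b)))" by (simp add: sum_distrib_left)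
        also have "\<dots> \<le> ?t w * (\<Sum>b\<in>I. \<beta> (canonical_edge (last w, b)))"
          using fin \<beta>0 t0 by (intro mult_left_mono sum_mono2) auto
        also have "\<dots> \<le> ?t w * s"
          using w wne t0 by (intro mult_left_mono s) (auto simp: words_def subset_iff)
        finally show "(\<Sum>b\<in>I - set w. ?t (w @ [b])) \<le> ?t w * s" .
      qed
      also have "\<dots> \<le> real (card I) * s ^ (card (set \<pi>) - 1) * s"
        unfolding sum_distrib_right[symmetric] using snoc.IH s0' by (intro mult_right_mono)
      also have "\<dots> = real (card I) * s ^ (card (set (\<pi> @ [j])) - 1)"
      proof -
        have "j \<notin> set \<pi>" using sub True by auto
        moreover have "0 < card (set \<pi>)" using snoc.hyps by (simp add: card_gt_0_iff)
        ultimately have "card (set (\<pi> @ [j])) - 1 = Suc (card (set \<pi>) - 1)" by simp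
        then show ?thesis by simp
      qed
      finally show ?thesis .
    next
      case False
      have "(\<Sum>w\<in>words I (\<pi> @ [j]). ?t w) \<le> (\<Sum>w\<in>(\<lambda>w. w @ [w ! j]) ` {w \<in> words I \<pi>. w ! j \<in> set w}. ?t w)"
        using words_snoc_old[OF snoc.hyps False] fin t0 by (intro sum_mono2) (auto simp: finite_words)
      also have "\<dots> = (\<Sum>w\<in>{w \<in> words I \<pi>. w ! j \<in> set w}. ?t (w @ [w ! j]))"
        by (subst sum.reindex) (auto simp: inj_on_def)
      also have "\<dots> = (\<Sum>w\<in>{w \<in> words I \<pi>. w ! j \<in> set w}. ?t w)"
      proof (intro sum.cong refl)
        fix w assume w: "w \<in> {w \<in> words I \<pi>. w ! j \<in> set w}"
        then have "w \<noteq> []" using snoc.hyps by (auto simp: words_def)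
        then show "?t (w @ [w ! j]) = ?t w" using w by (simp add: tree_edges_snoc)
      qed
      also have "\<dots> \<le> (\<Sum>w\<in>words I \<pi>. ?t w)"
        using fin t0 by (intro sum_mono2) (auto simp: finite_words)
      also have "\<dots> \<le> real (card I) * s ^ (card (set \<pi>) - 1)" by (rule snoc.IH)
      \<comment> \<open>The exponent does not change: the witness shows that \<open>j\<close> is a
        first position, hence already a letter of \<pi>.\<close>
      also have "\<dots> = real (card I) * s ^ (card (set (\<pi> @ [j])) - 1)"
      proof -
        obtain w where w: "w \<in> words I \<pi>" "w @ [w ! j] = v" "w ! j \<in> set w"
          using words_snoc_old[OF snoc.hyps False] \<open>v \<in> words I (\<pi> @ [j])\<close> by blast
        have "pattern (w @ [w ! j]) = \<pi> @ [j]" using w \<open>v \<in> words I (\<pi> @ [j])\<close> by (simp add: words_def)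
        then have "j = first_index w (w ! j)" unfolding pattern_snoc using w(3) by simp
        then have "j \<in> set \<pi>" using w by (auto simp: words_def pattern_def)
        then show ?thesis by (simp add: insert_absorb)
      qed
      finally show ?thesis .
    qed
  qed
qed

text \<open>The count is a falling factorial starting at \<open>r\<close>. A new vertex found after
  \<open>d\<close> others, with \<open>d \<le> p\<close>, has \<open>r - d\<close> choices, and
  \<open>r - d \<ge> s\<close>. This is the reason for taking \<open>r\<close> at least
  \<open>s + p\<close>, where \<open>s\<close> stands for the square of \<sigma>.\<close>

lemma card_words_ge:
  assumes "0 \<le> s" "s + real p \<le> real r" "w0 \<noteq> []" "card (set w0) \<le> Suc p"
  shows "real r * s ^ (card (set w0) - 1) \<le> real (card (words {..<r} (pattern w0)))"
  using assms(3,4)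
proof (induction w0 rule: rev_nonempty_induct)
  case (single a)
  have "words {..<r} (pattern [a]) = (\<lambda>a. [a]) ` {..<r}"
  proof (intro equalityI subsetI)
    fix w assume "w \<in> words {..<r} (pattern [a])"
    then have "set w \<subseteq> {..<r}" "length w = 1" by (auto simp: words_def dest: arg_cong[of _ _ length])
    then show "w \<in> (\<lambda>a. [a]) ` {..<r}" by (cases w) auto
  qed (auto simp: words_def pattern_def first_index_def)
  then show ?case by (simp add: card_image inj_on_def)
next
  case (snoc c w0)
  let ?J = "{..<r}" and ?\<pi> = "pattern w0"
  have IH: "real r * s ^ (card (set w0) - 1) \<le> real (card (words ?J ?\<pi>))"
    using snoc by (intro snoc.IH) (auto intro: order_trans[OF card_mono])
  have \<pi>: "?\<pi> \<noteq> []" using snoc by simp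
  show ?case
  proof (cases "c \<in> set w0")
    case True
    let ?j = "first_index w0 c"
    have j: "?j < length w0" "w0 ! ?j = c" using True by (auto simp: first_index_less nth_first_index)
    have "(\<lambda>w. w @ [w ! ?j]) ` words ?J ?\<pi> \<subseteq> words ?J (?\<pi> @ [?j])"
    proof (intro image_subsetI)
      fix w assume w: "w \<in> words ?J ?\<pi>"
      then have len: "length w = length w0" by (auto simp: words_def dest: arg_cong[of _ _ length])
      have "first_index w (w ! ?j) = pattern w ! ?j" using j len by (simp add: pattern_def)
      also have "\<dots> = pattern w0 ! ?j" using w by (simp add: words_def)
      also have "\<dots> = ?j" using j by (simp add: pattern_def)
      finally have "pattern (w @ [w ! ?j]) = ?\<pi> @ [?j]" using w j len by (simp add: pattern_snoc words_def)
      then show "w @ [w ! ?j] \<in> words ?J (?\<pi> @ [?j])"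
        using w j(1) len nth_mem[of ?j w] unfolding words_def by (simp add: subset_iff)
    qed
    then have "card ((\<lambda>w. w @ [w ! ?j]) ` words ?J ?\<pi>) \<le> card (words ?J (?\<pi> @ [?j]))"
      by (intro card_mono finite_words) auto
    moreover have "card ((\<lambda>w. w @ [w ! ?j]) ` words ?J ?\<pi>) = card (words ?J ?\<pi>)"
      by (rule card_image) (auto simp: inj_on_def)
    ultimately show ?thesis using IH True by (simp add: pattern_snoc insert_absorb)
  next
    case False
    let ?d = "card (set w0)"
    have d: "0 < ?d" "?d \<le> p" using snoc False by (auto simp: card_gt_0_iff)
    have card_w: "card (set w) = ?d" if "w \<in> words ?J ?\<pi>" for w
      using that card_set_pattern[of w] card_set_pattern[of w0] by (simp add: words_def)
    have "words ?J (pattern (w0 @ [c])) = (\<lambda>(w, b). w @ [b]) ` (SIGMA w:words ?J ?\<pi>. ?J - set w)"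
      using words_snoc_new[OF \<pi>, of ?J] False by (simp add: pattern_snoc)
    then have "card (words ?J (pattern (w0 @ [c]))) = card (SIGMA w:words ?J ?\<pi>. ?J - set w)"
      by (simp add: card_image inj_on_def)
    also have "\<dots> = (\<Sum>w\<in>words ?J ?\<pi>. card (?J - set w))"
      by (simp add: finite_words)
    also have "\<dots> = (\<Sum>w\<in>words ?J ?\<pi>. r - ?d)"
      using card_w by (intro sum.cong refl) (auto simp: words_def card_Diff_subset)
    finally have card_eq: "card (words ?J (pattern (w0 @ [c]))) = card (words ?J ?\<pi>) * (r - ?d)" by simp
    have "s \<le> real (r - ?d)" using assms(1,2) d by (simp add: of_nat_diff)
    then have "real r * s ^ (?d - 1) * s \<le> real (card (words ?J ?\<pi>)) * real (r - ?d)"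
      using IH assms(1) by (intro mult_mono) auto
    moreover have "card (set (w0 @ [c])) - 1 = Suc (?d - 1)" using d False by simp
    ultimately show ?thesis unfolding card_eq by (simp add: mult_ac)
  qed
qed

section \<open>Comparison of the two moments shape by shape\<close>

text \<open>The expected product of entries of the orthogonal ensemble along the walk.\<close>

definition shape_coeff :: "'i list \<Rightarrow> real" where "shape_coeff w = wick goe_cov (edges w)"

lemma shape_coeff_nonneg: "0 \<le> shape_coeff w"
  unfolding shape_coeff_def using wick_mono[of "edges w" goe_cov goe_cov] by (simp add: goe_cov_def)

text \<open>\<open>goe_cov\<close> sees only coincidences of vertices, and
  \<open>first_index\<close> is injective on the vertices of the walk.\<close>

lemma shape_coeff_pattern: "shape_coeff (pattern w) = shape_coeff w"
proof -
  have "wick goe_cov (edges (pattern w)) = wick (\<lambda>e f. goe_cov (map_prod (first_index w) (first_index w) e) (map_prod (first_index w) (first_index w) f)) (edges w)"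
    by (simp add: pattern_def edges_map wick_map)
  also have "\<dots> = wick goe_cov (edges w)"
  proof (rule wick_cong)
    fix e f assume "e \<in> set (edges w)" "f \<in> set (edges w)"
    then have "fst e \<in> set w" "snd e \<in> set w" "fst f \<in> set w" "snd f \<in> set w"
      using set_edges_subset[of w] by auto
    then show "goe_cov (map_prod (first_index w) (first_index w) e) (map_prod (first_index w) (first_index w) f) = goe_cov e f"
      by (simp add: goe_cov_def inj_on_eq_iff[OF inj_on_first_index])
  qed
  finally show ?thesis by (simp add: shape_coeff_def)
qed

text \<open>Closedness is a coincidence between the first and the last letter, hence a property of
  the pattern.\<close>

lemma words_subset_closed_walks:
  assumes "w0 \<in> closed_walks I m"
  shows "words J (pattern w0) \<subseteq> closed_walks J m"
proof
  fix w assume w: "w \<in> words J (pattern w0)"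
  have w0: "w0 \<noteq> []" "length w0 = Suc m" "hd w0 = last w0" using assms by (auto simp: closed_walks_def)
  have len: "length w = Suc m" using w w0 by (auto simp: words_def dest: arg_cong[of _ _ length])
  then have ne: "w \<noteq> []" by auto
  have "first_index w (hd w) = hd (pattern w)" "first_index w (last w) = last (pattern w)"
    using ne by (simp_all add: pattern_def hd_map last_map)
  moreover have "hd (pattern w0) = last (pattern w0)" using w0 by (simp add: pattern_def hd_map last_map)
  ultimately have "hd w = last w"
    using w ne inj_on_first_index[of w] by (auto simp: words_def inj_on_def)
  then show "w \<in> closed_walks J m" using w len by (simp add: words_def closed_walks_def)
qed

text \<open>Within one shape the coefficient is constant, so the upper count over \<open>I\<close>
  is compared with the lower count over \<open>{..<r}\<close>. Distinct shapes give disjoint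
  families of walks in \<open>{..<r}\<close>, so the comparisons can be added up.\<close>

lemma shape_comparison:
  fixes \<beta> :: "'i::linorder \<times> 'i \<Rightarrow> real"
  assumes fin: "finite I" and \<beta>0: "\<And>e. 0 \<le> \<beta> e" and s: "\<And>a. a \<in> I \<Longrightarrow> (\<Sum>c\<in>I. \<beta> (canonical_edge (a, c))) \<le> s"
    and s0: "0 \<le> s" and r: "s + real p \<le> real r" "0 < r"
    and small: "\<And>w. w \<in> closed_walks I m \<Longrightarrow> shape_coeff w \<noteq> 0 \<Longrightarrow> card (set w) \<le> Suc p"
  shows "(\<Sum>w\<in>closed_walks I m. shape_coeff w * (\<Prod>e\<in>tree_edges w. \<beta> e))
      \<le> real (card I) / real r * (\<Sum>v\<in>closed_walks {..<r} m. shape_coeff v)"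
proof -
  let ?P = "pattern ` closed_walks I m" and ?t = "\<lambda>w. \<Prod>e\<in>tree_edges w. \<beta> e"
  have finP: "finite ?P" using fin by (simp add: finite_closed_walks)
  have "(\<Sum>w\<in>closed_walks I m. shape_coeff w * ?t w)
      = (\<Sum>\<pi>\<in>?P. \<Sum>w\<in>{w \<in> closed_walks I m. pattern w = \<pi>}. shape_coeff w * ?t w)"
    using fin by (intro sum.image_gen finite_closed_walks)
  also have "\<dots> \<le> (\<Sum>\<pi>\<in>?P. real (card I) / real r * (\<Sum>v\<in>words {..<r} \<pi>. shape_coeff v))"
  proof (intro sum_mono)
    fix \<pi> assume "\<pi> \<in> ?P"
    then obtain w0 where w0: "w0 \<in> closed_walks I m" "\<pi> = pattern w0" by blast
    then have ne: "w0 \<noteq> []" by (auto simp: closed_walks_def)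
    have cf: "shape_coeff w = shape_coeff \<pi>" if "w \<in> words J \<pi>" for w :: "'j list" and J
      using that shape_coeff_pattern[of w] by (simp add: words_def)
    have "{w \<in> closed_walks I m. pattern w = \<pi>} = words I \<pi>"
      using words_subset_closed_walks[OF w0(1), of I] w0 by (auto simp: words_def closed_walks_def)
    then have "(\<Sum>w\<in>{w \<in> closed_walks I m. pattern w = \<pi>}. shape_coeff w * ?t w)
        = shape_coeff \<pi> * (\<Sum>w\<in>words I \<pi>. ?t w)"
      by (simp add: cf sum_distrib_left)
    also have "\<dots> \<le> shape_coeff \<pi> * (real (card I) / real r * real (card (words {..<r} \<pi>)))"
    proof (cases "shape_coeff \<pi> = 0")
      case False
      then have "card (set w0) \<le> Suc p" using small[OF w0(1)] w0 shape_coeff_pattern[of w0] by simp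
      then have 1: "real r * s ^ (card (set w0) - 1) \<le> real (card (words {..<r} \<pi>))"
        unfolding w0(2) using s0 r ne by (intro card_words_ge) auto
      have "(\<Sum>w\<in>words I \<pi>. ?t w) \<le> real (card I) * s ^ (card (set w0) - 1)"
        using sum_words_le[OF fin \<beta>0 s, of \<pi>] ne w0(2) by (simp add: card_set_pattern)
      also have "\<dots> = real (card I) / real r * (real r * s ^ (card (set w0) - 1))" using r by simp
      also have "\<dots> \<le> real (card I) / real r * real (card (words {..<r} \<pi>))"
        using 1 by (intro mult_left_mono) auto
      finally show ?thesis using shape_coeff_nonneg by (intro mult_left_mono)
    qed simp
    also have "\<dots> = real (card I) / real r * (\<Sum>v\<in>words {..<r} \<pi>. shape_coeff v)"
      by (simp add: cf)
    finally show "(\<Sum>w\<in>{w \<in> closed_walks I m. pattern w = \<pi>}. shape_coeff w * ?t w)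
        \<le> real (card I) / real r * (\<Sum>v\<in>words {..<r} \<pi>. shape_coeff v)" .
  qed
  also have "\<dots> = real (card I) / real r * (\<Sum>v\<in>(\<Union>\<pi>\<in>?P. words {..<r} \<pi>). shape_coeff v)"
  proof -
    have "(\<Sum>v\<in>(\<Union>\<pi>\<in>?P. words {..<r} \<pi>). shape_coeff v) = (\<Sum>\<pi>\<in>?P. \<Sum>v\<in>words {..<r} \<pi>. shape_coeff v)"
    proof (rule sum.UNION_disjoint[OF finP])
      show "\<forall>\<pi>\<in>?P. finite (words {..<r} \<pi>)" by (simp add: finite_words)
    qed (auto simp: words_def)
    then show ?thesis by (simp add: sum_distrib_left)
  qed
  also have "\<dots> \<le> real (card I) / real r * (\<Sum>v\<in>closed_walks {..<r} m. shape_coeff v)"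
  proof -
    have "(\<Union>\<pi>\<in>?P. words {..<r} \<pi>) \<subseteq> closed_walks {..<r} m" using words_subset_closed_walks by blast
    then show ?thesis by (intro mult_left_mono sum_mono2) (auto simp: finite_closed_walks shape_coeff_nonneg)
  qed
  finally show ?thesis .
qed

section \<open>Multiplicities of edges in contributing walks\<close>

text \<open>Some matching has a nonzero product, and it pairs each letter with one of the same
  canonical edge. The induction removes one such pair at a time.\<close>

lemma even_count_if_wick_nonzero:
  fixes L :: "('i::linorder \<times> 'i) list"
  assumes "wick goe_cov L \<noteq> 0"
  shows "even (count_list (map canonical_edge L) u)"
  using assms
proof (induction "length L" arbitrary: L rule: less_induct)
  case less
  show ?case
  proof (cases L)
    case (Cons e L')
    have "\<exists>j\<in>{..<length L'}. goe_cov e (L' ! j) * wick goe_cov (del_nth j L') \<noteq> 0"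
      using less.prems unfolding Cons wick.simps by (meson sum.not_neutral_contains_not_neutral)
    then obtain j where j: "j < length L'" "goe_cov e (L' ! j) \<noteq> 0" "wick goe_cov (del_nth j L') \<noteq> 0"
      by auto
    have ev: "even (count_list (map canonical_edge (del_nth j L')) u)"
      using j by (intro less.hyps) (auto simp: Cons length_del_nth)
    have "canonical_edge e = canonical_edge (L' ! j)" using j(2) by (simp add: goe_cov_eq_0_iff)
    moreover have "count_list (map canonical_edge (del_nth j L')) u = count_list (map canonical_edge L') u - (if canonical_edge (L' ! j) = u then 1 else 0)"
      using count_list_del_nth[of j "map canonical_edge L'" u] j by (simp add: map_del_nth)
    moreover have "count_list (map canonical_edge L') (canonical_edge (L' ! j)) \<noteq> 0"
      using j(1) unfolding count_list_0_iff by simp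
    ultimately show ?thesis using ev by (cases "canonical_edge (L' ! j) = u") (simp_all add: Cons)
  qed simp
qed

lemma count_edge_ge_2:
  assumes "shape_coeff w \<noteq> 0" "u \<in> canonical_edge ` set (edges w)"
  shows "2 \<le> count_list (map canonical_edge (edges w)) u"
proof -
  have "even (count_list (map canonical_edge (edges w)) u)"
    using assms(1) unfolding shape_coeff_def by (rule even_count_if_wick_nonzero)
  moreover have "count_list (map canonical_edge (edges w)) u \<noteq> 0"
    using assms(2) by (simp add: count_list_0_iff)
  ultimately show ?thesis by (simp add: dvd_imp_le)
qed

text \<open>Each tree edge takes at least two of the \<open>2 * p\<close> steps, so there are at
  most \<open>p\<close> tree edges, and a tree has one vertex more than edges.\<close>

lemma card_set_le_if_shape_coeff_nonzero:
  fixes w :: "'i::linorder list"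
  assumes "shape_coeff w \<noteq> 0" "length w = Suc (2 * p)"
  shows "card (set w) \<le> Suc p"
proof -
  let ?L = "map canonical_edge (edges w)"
  have "2 * card (tree_edges w) \<le> (\<Sum>u\<in>tree_edges w. count_list ?L u)"
  proof -
    have "(\<Sum>u\<in>tree_edges w. 2) \<le> (\<Sum>u\<in>tree_edges w. count_list ?L u)"
      using tree_edges_subset[of w] by (intro sum_mono count_edge_ge_2[OF assms(1)]) blast
    then show ?thesis by simp
  qed
  also have "\<dots> \<le> (\<Sum>u\<in>set ?L. count_list ?L u)"
    using tree_edges_subset[of w] by (intro sum_mono2) auto
  also have "\<dots> = 2 * p" by (simp only: sum_count_set[OF subset_refl finite_set]) (simp add: length_edges assms)
  finally show ?thesis using card_tree_edges[of w] assms(2) by (cases w) auto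
qed

lemma prod_edges_le:
  fixes b :: "'i::linorder \<times> 'i \<Rightarrow> real"
  assumes "shape_coeff w \<noteq> 0" and b: "\<And>e. \<bar>b e\<bar> \<le> 1" and b_can: "\<And>e. b (canonical_edge e) = b e"
  shows "(\<Prod>e\<leftarrow>edges w. \<bar>b e\<bar>) \<le> (\<Prod>e\<in>tree_edges w. (b e)\<^sup>2)"
proof -
  let ?L = "map canonical_edge (edges w)"
  have "(\<Prod>e\<leftarrow>edges w. \<bar>b e\<bar>) = (\<Prod>e\<leftarrow>?L. \<bar>b e\<bar>)" by (simp add: b_can comp_def)
  also have "\<dots> = (\<Prod>u\<in>set ?L. \<bar>b u\<bar> ^ count_list ?L u)"
    by (rule prod_list_map_count) auto
  also have "\<dots> \<le> (\<Prod>u\<in>set ?L. if u \<in> tree_edges w then (b u)\<^sup>2 else 1)"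
  proof (intro prod_mono conjI)
    fix u assume u: "u \<in> set ?L"
    have "\<bar>b u\<bar> ^ count_list ?L u \<le> \<bar>b u\<bar> ^ 2"
      using count_edge_ge_2[OF assms(1), of u] u b[of u] by (intro power_decreasing) auto
    moreover have "\<bar>b u\<bar> ^ count_list ?L u \<le> 1" using b[of u] by (intro power_le_one) auto
    ultimately show "\<bar>b u\<bar> ^ count_list ?L u \<le> (if u \<in> tree_edges w then (b u)\<^sup>2 else 1)" by auto
  qed auto
  also have "\<dots> = (\<Prod>u\<in>tree_edges w. (b u)\<^sup>2)"
    using tree_edges_subset[of w] by (subst prod.inter_filter[symmetric]) (auto intro!: prod.cong)
  finally show ?thesis .
qed

section \<open>A supersolution of the loop equations\<close>

text \<open>The ratio recursion makes the growth bounds immediate inductions; the convolution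
  identity is then what has to be proved.\<close>

primrec catalan :: "nat \<Rightarrow> real" where
  "catalan 0 = 1"
| "catalan (Suc k) = real (4 * k + 2) / real (k + 2) * catalan k"

lemma catalan_pos: "0 < catalan k"
  by (induction k) auto

text \<open>Symmetry gives \<open>\<Sum>i\<le>n. i C\<^sub>i C\<^sub>n\<^sub>-\<^sub>i = n / 2 \<Sum>i\<le>n. C\<^sub>i C\<^sub>n\<^sub>-\<^sub>i\<close>, which turns the
  hypergeometric recursion into the convolution identity.\<close>

lemma catalan_convolution: "(\<Sum>i\<le>n. catalan i * catalan (n - i)) = catalan (Suc n)"
proof (induction n)
  case (Suc n)
  define S where "S n = (\<Sum>i\<le>n. catalan i * catalan (n - i))" for n
  have lin: "(\<Sum>i\<le>n. real i * (catalan i * catalan (n - i))) = real n / 2 * S n" for n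
  proof -
    have "(\<Sum>i\<le>n. real i * (catalan i * catalan (n - i)))
        = (\<Sum>i\<le>n. real (n - i) * (catalan (n - i) * catalan (n - (n - i))))"
      by (rule sum.reindex_bij_witness[of _ "\<lambda>i. n - i" "\<lambda>i. n - i"]) auto
    also have "\<dots> = (\<Sum>i\<le>n. real n * (catalan i * catalan (n - i)) - real i * (catalan i * catalan (n - i)))"
      by (intro sum.cong) (auto simp: of_nat_diff algebra_simps)
    also have "\<dots> = real n * S n - (\<Sum>i\<le>n. real i * (catalan i * catalan (n - i)))"
      by (simp add: sum_subtractf sum_distrib_left S_def)
    finally show ?thesis by simp
  qed
  \<comment> \<open>By symmetry the weight \<open>i + 1\<close> averages to (n + 3) / 2. After the
    shift i to i + 1 it becomes i + 2, the denominator in the recursion of \<open>catalan\<close>,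
    and cancels.\<close>
  have "real (n + 3) / 2 * S (Suc n) = (\<Sum>i\<le>Suc n. (real i + 1) * (catalan i * catalan (Suc n - i)))"
    unfolding distrib_right sum.distrib lin mult_1_left S_def[symmetric] by (simp add: field_simps)
  also have "\<dots> = catalan (Suc n) + (\<Sum>i\<le>n. (real (Suc i) + 1) * catalan (Suc i) * catalan (n - i))"
    by (subst sum.atMost_Suc_shift) (simp add: mult.assoc)
  also have "(\<Sum>i\<le>n. (real (Suc i) + 1) * catalan (Suc i) * catalan (n - i))
      = (\<Sum>i\<le>n. 4 * (real i * (catalan i * catalan (n - i))) + 2 * (catalan i * catalan (n - i)))"
    by (intro sum.cong refl) (simp add: field_simps)
  also have "\<dots> = (2 * real n + 2) * S n"
    unfolding sum.distrib sum_distrib_left[symmetric] lin S_def[symmetric] by (simp add: field_simps)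
  also have "S n = catalan (Suc n)" using Suc by (simp add: S_def)
  finally have "real (n + 3) / 2 * S (Suc n) = (2 * real n + 3) * catalan (Suc n)"
    by (simp add: algebra_simps del: catalan.simps)
  moreover have "real (n + 3) / 2 * catalan (Suc (Suc n)) = (2 * real n + 3) * catalan (Suc n)"
    unfolding catalan.simps(2)[of "Suc n"] by (simp add: field_simps del: catalan.simps)
  ultimately have "S (Suc n) = catalan (Suc (Suc n))"
    by (metis mult_cancel_left divide_eq_0_iff of_nat_eq_0_iff add_is_0 zero_neq_numeral)
  then show ?case by (simp only: S_def)
qed simp

lemma catalan_Suc_le: "catalan (Suc k) \<le> 4 * catalan k"
  using catalan_pos[of k] by (simp add: field_simps)

lemma catalan_le: "real (k + 1) * catalan k \<le> 4 ^ k"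
proof (induction k)
  case (Suc k)
  have "real (Suc k + 1) * catalan (Suc k) = real (4 * k + 2) * catalan k" by (simp add: field_simps)
  also have "\<dots> \<le> 4 * (real (k + 1) * catalan k)" using catalan_pos[of k] by (simp add: algebra_simps)
  also have "\<dots> \<le> 4 ^ Suc k" using Suc by simp
  finally show ?case .
qed simp

text \<open>By the convolution identity each partial sum is at most \<open>1 + z * q^2\<close> with
  \<open>q\<close> the previous one, so any \<open>M\<close> with \<open>1 + z * M^2 \<le> M\<close>
  stays an upper bound. Convergence of the series is not invoked.\<close>

lemma catalan_series_le:
  assumes "0 \<le> z" and M: "1 + z * M\<^sup>2 \<le> M"
  shows "(\<Sum>i<k. catalan i * z ^ i) \<le> M"
proof (induction k)
  case 0
  have "0 \<le> 1 + z * M\<^sup>2" using assms by simp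
  then show ?case using M by simp
next
  case (Suc k)
  let ?u = "\<lambda>i. catalan i * z ^ i"
  have u0: "0 \<le> ?u i" for i using catalan_pos[of i] assms by simp
  have "(\<Sum>i<Suc k. ?u i) = 1 + (\<Sum>i<k. z * (\<Sum>j\<le>i. ?u j * ?u (i - j)))"
  proof -
    have "?u (Suc i) = z * (\<Sum>j\<le>i. ?u j * ?u (i - j))" for i
    proof -
      have "(\<Sum>j\<le>i. ?u j * ?u (i - j)) = (\<Sum>j\<le>i. catalan j * catalan (i - j) * z ^ i)"
        by (intro sum.cong refl) (simp add: power_add[symmetric] mult_ac)
      also have "\<dots> = catalan (Suc i) * z ^ i"
        unfolding sum_distrib_right[symmetric] catalan_convolution ..
      finally show ?thesis by (simp del: catalan.simps)
    qed
    then show ?thesis unfolding sum.lessThan_Suc_shift by simp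
  qed
  also have "(\<Sum>i<k. z * (\<Sum>j\<le>i. ?u j * ?u (i - j))) = z * (\<Sum>(i, j)\<in>(SIGMA i:{..<k}. {..i}). ?u j * ?u (i - j))"
    by (simp add: sum_distrib_left[symmetric] sum.Sigma)
  also have "(\<Sum>(i, j)\<in>(SIGMA i:{..<k}. {..i}). ?u j * ?u (i - j))
      = (\<Sum>(j, l)\<in>{(j, l). j + l < k}. ?u j * ?u l)"
    by (rule sum.reindex_bij_witness[of _ "\<lambda>(j, l). (j + l, j)" "\<lambda>(i, j). (j, i - j)"]) auto
  also have "\<dots> \<le> (\<Sum>(j, l)\<in>{..<k} \<times> {..<k}. ?u j * ?u l)"
    using u0 by (intro sum_mono2) auto
  also have "\<dots> = (\<Sum>i<k. ?u i)\<^sup>2"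
    by (simp add: power2_eq_square sum_product sum.cartesian_product)
  also have "\<dots> \<le> M\<^sup>2" using Suc u0 by (intro power_mono sum_nonneg) auto
  finally show ?case using M assms(1) by (simp add: mult_left_mono order_trans[OF _ M])
qed

section \<open>Weights and the inequalities required of them\<close>

definition even_weight :: "real \<Rightarrow> real \<Rightarrow> real \<Rightarrow> nat \<Rightarrow> real" where
  "even_weight x y \<Lambda> k = x * (y ^ k * catalan k) + \<Lambda> ^ k"

text \<open>The loop equations expand one factor at a time. When an odd trace is present, the larger of the
  odd ones is expanded, so that at most two odd traces occur at any stage. The bound is a product of
  \<open>even_weight\<close> over the even traces, times \<open>\<kappa> * \<Lambda> ^ ((a + b) div 2)\<close> if odd traces \<open>a\<close> and \<open>b\<close>
  are present. The Catalan part of \<open>even_weight\<close> describes a semicircle law of variance \<open>y\<close>, its second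
  part a single eigenvalue \<open>sqrt \<Lambda>\<close> outside the bulk.\<close>

locale supersolution =
  fixes p :: nat and x y \<Lambda> \<kappa> M :: real
  assumes p: "1 \<le> p" and x: "0 < x" and y: "y = x + real p" and \<kappa>: "1 \<le> \<kappa>"
    and series: "\<And>k. (\<Sum>i<k. catalan i * (y / \<Lambda>) ^ i) \<le> M"
    and \<Lambda>y: "4 * y \<le> \<Lambda>"
    and \<Lambda>_even: "2 * x * M + (3 + \<kappa>) * real p \<le> \<Lambda>"
    and \<Lambda>_odd: "\<kappa> * (2 * x * M + 4 * real p) + 2 * x \<le> \<kappa> * \<Lambda>"
begin

abbreviation even_wt :: "nat \<Rightarrow> real" where "even_wt \<equiv> even_weight x y \<Lambda>"

lemma y_pos: "0 < y" and \<Lambda>_pos: "0 < \<Lambda>"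
  using x y \<Lambda>y p by auto

lemma power_le_even_weight: "\<Lambda> ^ k \<le> even_wt k"
  using x y_pos catalan_pos[of k] by (simp add: even_weight_def)

lemma even_weight_pos: "0 < even_wt k"
  using power_le_even_weight[of k] \<Lambda>_pos by (meson less_le_trans zero_less_power)

text \<open>Catalan ratios are at most 4 and \<open>4 * y \<le> \<Lambda>\<close>, so each step
  costs at most a factor \<Lambda>. This controls the merging of two even traces.\<close>

lemma even_weight_add_le: "even_wt (k + l) \<le> \<Lambda> ^ k * even_wt l"
proof (induction k)
  case (Suc k)
  have "y ^ Suc (k + l) * catalan (Suc (k + l)) \<le> y ^ Suc (k + l) * (4 * catalan (k + l))"
    using y_pos catalan_Suc_le[of "k + l"] by (intro mult_left_mono) auto
  also have "\<dots> = (4 * y) * (y ^ (k + l) * catalan (k + l))" by simp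
  also have "\<dots> \<le> \<Lambda> * (y ^ (k + l) * catalan (k + l))"
    using y_pos catalan_pos[of "k + l"] \<Lambda>y by (intro mult_right_mono) auto
  finally have "even_wt (Suc k + l) \<le> \<Lambda> * even_wt (k + l)"
    using x unfolding even_weight_def by (simp add: algebra_simps del: catalan.simps)
  also have "\<dots> \<le> \<Lambda> * (\<Lambda> ^ k * even_wt l)"
    using Suc \<Lambda>_pos by (intro mult_left_mono) auto
  finally show ?case by (simp add: mult.assoc)
qed simp

lemma series_power_le: "k \<le> n \<Longrightarrow> (\<Sum>i<k. y ^ i * catalan i * \<Lambda> ^ (n - i)) \<le> M * \<Lambda> ^ n"
proof -
  assume kn: "k \<le> n"
  have "(\<Sum>i<k. y ^ i * catalan i * \<Lambda> ^ (n - i)) = (\<Sum>i<k. catalan i * (y / \<Lambda>) ^ i) * \<Lambda> ^ n"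
    unfolding sum_distrib_right using \<Lambda>_pos kn
    by (intro sum.cong refl) (auto simp: power_diff power_divide)
  then show ?thesis using series[of k] \<Lambda>_pos by (simp add: mult_right_mono)
qed

lemma series_power_atMost_le: "(\<Sum>i\<le>n. y ^ i * catalan i * \<Lambda> ^ (n - i)) \<le> M * \<Lambda> ^ n"
proof -
  have "(\<Sum>i\<le>n. y ^ i * catalan i * \<Lambda> ^ (n - i)) = (\<Sum>i<Suc n. catalan i * (y / \<Lambda>) ^ i) * \<Lambda> ^ n"
    unfolding sum_distrib_right lessThan_Suc_atMost using \<Lambda>_pos
    by (intro sum.cong refl) (auto simp: power_diff power_divide)
  then show ?thesis using series[of "Suc n"] \<Lambda>_pos by (simp add: mult_right_mono del: sum.lessThan_Suc)
qed

text \<open>The loop equation for an even trace, divided by the weights of the others: splits into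
  two even traces, splits into two odd ones, the twisted term, and mergers. The surplus
  \<open>p\<close> in \<open>y = x + p\<close> lets the Catalan part absorb the twisted term;
  everything else is charged to the power of \<Lambda>.\<close>

lemma even_step:
  assumes N: "2 * k + 2 + n \<le> 2 * p"
  shows "(\<Sum>i\<le>k. even_wt i * even_wt (k - i)) + real k * (\<kappa> * \<Lambda> ^ k)
     + real (2 * k + 1) * even_wt k + 2 * real n * \<Lambda> ^ k \<le> even_wt (Suc k)"
proof -
  let ?m = "\<lambda>i. y ^ i * catalan i"
  have m0: "0 < ?m i" for i using y_pos catalan_pos by simp
  have conv: "y * (\<Sum>i\<le>k. ?m i * ?m (k - i)) = ?m (Suc k)"
  proof -
    have "(\<Sum>i\<le>k. ?m i * ?m (k - i)) = (\<Sum>i\<le>k. y ^ k * (catalan i * catalan (k - i)))"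
      by (intro sum.cong refl) (simp add: power_add[symmetric] mult_ac)
    then show ?thesis by (simp add: sum_distrib_left[symmetric] catalan_convolution del: catalan.simps)
  qed
  have low: "real (2 * k + 1) * ?m k \<le> real p * (\<Sum>i\<le>k. ?m i * ?m (k - i))"
  proof (cases k)
    case 0
    then show ?thesis using p by simp
  next
    case (Suc k')
    \<comment> \<open>The two end terms of the convolution, distinct because \<open>k\<close> is
      positive here.\<close>
    have "2 * ?m k = (\<Sum>i\<in>{0, k}. ?m i * ?m (k - i))" using Suc by (simp del: catalan.simps(2))
    also have "\<dots> \<le> (\<Sum>i\<le>k. ?m i * ?m (k - i))"
      using m0 by (intro sum_mono2) (auto intro!: mult_nonneg_nonneg less_imp_le)
    finally have "real p * (2 * ?m k) \<le> real p * (\<Sum>i\<le>k. ?m i * ?m (k - i))" by (intro mult_left_mono) auto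
    moreover have "real (2 * k + 1) * ?m k \<le> (2 * real p) * ?m k"
      using N m0[of k] by (intro mult_right_mono) auto
    ultimately show ?thesis by simp
  qed
  have sum_eq: "(\<Sum>i\<le>k. even_wt i * even_wt (k - i))
     = x\<^sup>2 * (\<Sum>i\<le>k. ?m i * ?m (k - i)) + 2 * x * (\<Sum>i\<le>k. ?m i * \<Lambda> ^ (k - i)) + real (k + 1) * \<Lambda> ^ k"
  proof -
    have "(\<Sum>i\<le>k. \<Lambda> ^ i * ?m (k - i)) = (\<Sum>i\<le>k. ?m i * \<Lambda> ^ (k - i))"
      by (rule sum.reindex_bij_witness[of _ "\<lambda>i. k - i" "\<lambda>i. k - i"]) auto
    moreover have "(\<Sum>i\<le>k. \<Lambda> ^ i * \<Lambda> ^ (k - i)) = real (k + 1) * \<Lambda> ^ k"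
      by (simp add: power_add[symmetric])
    moreover have "(\<Sum>i\<le>k. even_wt i * even_wt (k - i))
      = (\<Sum>i\<le>k. x\<^sup>2 * (?m i * ?m (k - i)) + x * (?m i * \<Lambda> ^ (k - i)) + x * (\<Lambda> ^ i * ?m (k - i)) + \<Lambda> ^ i * \<Lambda> ^ (k - i))"
      unfolding even_weight_def by (intro sum.cong refl) (simp add: algebra_simps power2_eq_square)
    ultimately show ?thesis by (simp add: sum.distrib sum_distrib_left[symmetric])
  qed
  have "x * (real (2 * k + 1) * ?m k) \<le> x * (real p * (\<Sum>i\<le>k. ?m i * ?m (k - i)))"
    using low x by (intro mult_left_mono) auto
  moreover have "x * ?m (Suc k) = x\<^sup>2 * (\<Sum>i\<le>k. ?m i * ?m (k - i)) + x * (real p * (\<Sum>i\<le>k. ?m i * ?m (k - i)))"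
  proof -
    have "x * (y * C) = x\<^sup>2 * C + x * (real p * C)" for C
      by (simp add: y algebra_simps power2_eq_square)
    then show ?thesis unfolding conv[symmetric] .
  qed
  ultimately have main: "x\<^sup>2 * (\<Sum>i\<le>k. ?m i * ?m (k - i)) + x * (real (2 * k + 1) * ?m k) \<le> x * ?m (Suc k)"
    by linarith
  have ser: "2 * x * (\<Sum>i\<le>k. ?m i * \<Lambda> ^ (k - i)) \<le> 2 * x * (M * \<Lambda> ^ k)"
    using series_power_atMost_le[of k] x by (intro mult_left_mono) auto
  have "(\<kappa> - 1) * real k \<le> (\<kappa> - 1) * real p" using \<kappa> N by (intro mult_left_mono) auto
  moreover have "real n \<le> 2 * real p - 2 * real k - 2" using N by linarith
  \<comment> \<open>With \<open>n \<le> 2 * p - 2 * k - 2\<close> the terms other than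
    \<open>2 * x * M\<close> add up to at most 4 p - 2 + (\<kappa> - 1) k, which is below (3 +
    \<kappa>) p.\<close>
  ultimately have "2 * x * M + real (k + 1) + real k * \<kappa> + real (2 * k + 1) + 2 * real n \<le> \<Lambda>"
    using \<Lambda>_even by (simp add: algebra_simps)
  then have "(2 * x * M + real (k + 1) + real k * \<kappa> + real (2 * k + 1) + 2 * real n) * \<Lambda> ^ k \<le> \<Lambda> * \<Lambda> ^ k"
    using \<Lambda>_pos by (intro mult_right_mono) auto
  then show ?thesis
    unfolding sum_eq using main ser
    by (simp add: even_weight_def algebra_simps del: catalan.simps)
qed

text \<open>The loop equation for the larger odd trace. The two mirror families of splits account
  for the first factor 2; the merger of the two odd traces is the only term without \<kappa>, and
  its Catalan part is the source of \<open>2 * x\<close> in \<open>\<Lambda>_odd\<close>.\<close>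

lemma odd_step:
  assumes ji: "j \<le> i" and N: "2 * i + 2 * j + 2 + n \<le> 2 * p"
  shows "2 * \<kappa> * (\<Sum>l<i. \<Lambda> ^ (i + j - l) * even_wt l) + 2 * real i * (\<kappa> * \<Lambda> ^ (i + j))
     + 2 * real (2 * j + 1) * even_wt (i + j) + 2 * real n * (\<kappa> * \<Lambda> ^ (i + j))
     \<le> \<kappa> * \<Lambda> ^ Suc (i + j)"
proof -
  let ?q = "\<Lambda> ^ (i + j)"
  have q: "0 < ?q" using \<Lambda>_pos by simp
  have "(\<Sum>l<i. \<Lambda> ^ (i + j - l) * even_wt l)
      = (\<Sum>l<i. x * (y ^ l * catalan l * \<Lambda> ^ (i + j - l)) + ?q)"
    unfolding even_weight_def
    by (intro sum.cong refl) (simp add: algebra_simps power_add[symmetric])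
  also have "\<dots> = x * (\<Sum>l<i. y ^ l * catalan l * \<Lambda> ^ (i + j - l)) + real i * ?q"
    by (simp add: sum.distrib sum_distrib_left)
  also have "\<dots> \<le> x * (M * ?q) + real i * ?q"
    using series_power_le[of i "i + j"] x by (intro add_right_mono mult_left_mono) auto
  finally have "2 * \<kappa> * (\<Sum>l<i. \<Lambda> ^ (i + j - l) * even_wt l) \<le> 2 * \<kappa> * (x * (M * ?q) + real i * ?q)"
    using \<kappa> by (intro mult_left_mono) auto
  moreover have "real (2 * j + 1) * even_wt (i + j) \<le> x * ?q + real (2 * j + 1) * ?q"
  proof -
    \<comment> \<open>Here \<open>j \<le> i\<close> is essential: it bounds the coefficient by i + j
      + 1, which the denominator of the Catalan number cancels. Hence the rule of expanding the
      larger odd trace.\<close>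
    have "real (2 * j + 1) * catalan (i + j) \<le> real (i + j + 1) * catalan (i + j)"
      using ji catalan_pos[of "i + j"] by (intro mult_right_mono) auto
    also have "\<dots> \<le> 4 ^ (i + j)" by (rule catalan_le)
    finally have "y ^ (i + j) * (real (2 * j + 1) * catalan (i + j)) \<le> y ^ (i + j) * 4 ^ (i + j)"
      using y_pos by (intro mult_left_mono) auto
    also have "\<dots> = (4 * y) ^ (i + j)" by (simp add: power_mult_distrib)
    also have "\<dots> \<le> ?q" using \<Lambda>y y_pos by (intro power_mono) auto
    finally have "x * (y ^ (i + j) * (real (2 * j + 1) * catalan (i + j))) \<le> x * ?q"
      using x by (intro mult_left_mono) auto
    then show ?thesis by (simp add: even_weight_def algebra_simps)
  qed
  moreover have "(\<kappa> * (2 * x * M + 4 * real i + 2 * real n) + 2 * x + 2 * real (2 * j + 1)) * ?q \<le> (\<kappa> * \<Lambda>) * ?q"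
  proof (intro mult_right_mono)
    have "2 * real i + 2 * real j + 2 + real n \<le> 2 * real p" using N by linarith
    then have "\<kappa> * (4 * real i + 2 * real n) \<le> \<kappa> * (4 * real p - 4 * real j - 4)"
      using \<kappa> by (intro mult_left_mono) auto
    moreover have "1 * (4 * real j + 4) \<le> \<kappa> * (4 * real j + 4)" using \<kappa> by (intro mult_right_mono) auto
    ultimately show "\<kappa> * (2 * x * M + 4 * real i + 2 * real n) + 2 * x + 2 * real (2 * j + 1) \<le> \<kappa> * \<Lambda>"
      using \<Lambda>_odd by (simp add: algebra_simps)
  qed (use q in auto)
  ultimately show ?thesis by (simp add: algebra_simps)
qed

end

section \<open>Induction over the total degree of a product of traces\<close>

lemma sum_list_del_nth:
  fixes L :: "nat list"
  shows "j < length L \<Longrightarrow> L ! j + sum_list (del_nth j L) = sum_list L"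
proof (induction L arbitrary: j)
  case (Cons a L)
  then show ?case by (cases j) auto
qed simp

lemma sum_split_parity:
  fixes f :: "nat \<Rightarrow> real"
  shows "(\<Sum>s<2 * i. f s) = (\<Sum>l<i. f (2 * l)) + (\<Sum>l<i. f (2 * l + 1))"
  by (induction i) auto

lemma sum_split_parity_odd:
  fixes f :: "nat \<Rightarrow> real"
  shows "(\<Sum>s<2 * i + 1. f s) = (\<Sum>l\<le>i. f (2 * l)) + (\<Sum>l<i. f (2 * l + 1))"
  by (simp add: sum_split_parity lessThan_Suc_atMost[symmetric])

locale goe_supersolution = goe M Y r + supersolution p "real r" y \<Lambda> \<kappa> B
  for M :: "'a measure" and Y r p y \<Lambda> \<kappa> B
begin

definition S :: "nat list \<Rightarrow> real" where "S ns = (\<Prod>n\<leftarrow>ns. even_wt (n div 2))"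

lemma S_simps [simp]: "S [] = 1" "S (n # ns) = even_wt (n div 2) * S ns"
  by (simp_all add: S_def)

lemma S_pos: "0 < S ns"
  by (induction ns) (auto simp: even_weight_pos)

lemma S_del_nth: "j < length ns \<Longrightarrow> S ns = even_wt (ns ! j div 2) * S (del_nth j ns)"
  using prod_list_del_nth[of j "map (\<lambda>n. even_wt (n div 2)) ns"] by (simp add: S_def map_del_nth)

text \<open>The loop equation expands only the head of the list; permutation invariance lets any
  trace be chosen.\<close>

lemma T_perm:
  assumes "mset ns = mset ms"
  shows "T ns = T ms"
proof -
  have "trs ns \<omega> = trs ms \<omega>" for \<omega>
    unfolding prod_mset_prod_list[symmetric] mset_map assms ..
  then show ?thesis by (simp add: T_def)
qed

lemma S_perm: "mset ns = mset ms \<Longrightarrow> S ns = S ms"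
  unfolding S_def prod_mset_prod_list[symmetric] mset_map by simp

lemma T_zeros: "\<forall>n\<in>set ns. n = 0 \<Longrightarrow> T ns = real r ^ length ns"
proof -
  assume "\<forall>n\<in>set ns. n = 0"
  then have "trs ns \<omega> = real r ^ length ns" for \<omega>
    by (induction ns) (auto simp: trace_power_def)
  then show ?thesis by (simp add: T_def prob_space)
qed

text \<open>The base case: a trace of order 0 equals \<open>r\<close>, while its weight is
  \<open>r + 1\<close>.\<close>

lemma S_zeros: "\<forall>n\<in>set ns. n = 0 \<Longrightarrow> real r ^ length ns \<le> S ns"
proof (induction ns)
  case (Cons n ns)
  then show ?case using mult_mono[of "real r" "even_wt 0" "real r ^ length ns" "S ns"]
    by (auto simp: even_weight_def)
qed simp

lemma T_even_step:
  assumes ev: "\<forall>n\<in>set ns. even n" and N: "2 * k + 2 + sum_list ns \<le> 2 * p"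
    and IHe: "\<And>ms. sum_list ms < 2 * k + 2 + sum_list ns \<Longrightarrow> \<forall>n\<in>set ms. even n \<Longrightarrow> T ms \<le> S ms"
    and IHo: "\<And>a b ms. a + b + sum_list ms < 2 * k + 2 + sum_list ns \<Longrightarrow> odd a \<Longrightarrow> odd b \<Longrightarrow>
      \<forall>n\<in>set ms. even n \<Longrightarrow> T (a # b # ms) \<le> \<kappa> * \<Lambda> ^ ((a + b) div 2) * S ms"
  shows "T ((2 * k + 2) # ns) \<le> even_wt (Suc k) * S ns"
proof -
  have 1: "T (2 * i # (2 * k - 2 * i) # ns) \<le> even_wt i * even_wt (k - i) * S ns" if "i \<le> k" for i
  proof -
    have "T (2 * i # (2 * k - 2 * i) # ns) \<le> S (2 * i # (2 * k - 2 * i) # ns)"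
      using that ev by (intro IHe) auto
    then show ?thesis by (simp add: diff_mult_distrib2[symmetric] mult.assoc)
  qed
  have 2: "T ((2 * i + 1) # (2 * k - (2 * i + 1)) # ns) \<le> \<kappa> * \<Lambda> ^ k * S ns" if "i < k" for i
    using IHo[of "2 * i + 1" "2 * k - (2 * i + 1)" ns] that ev by simp
  have 3: "T (2 * k # ns) \<le> even_wt k * S ns"
    using IHe[of "2 * k # ns"] ev by simp
  have 4: "2 * real (ns ! j) * T ((2 * k + ns ! j) # del_nth j ns) \<le> real (ns ! j) * (2 * \<Lambda> ^ k * S ns)"
    if j: "j < length ns" for j
  proof -
    have evj: "even (ns ! j)" using ev j by auto
    have "T ((2 * k + ns ! j) # del_nth j ns) \<le> even_wt (k + ns ! j div 2) * S (del_nth j ns)"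
      using IHe[of "(2 * k + ns ! j) # del_nth j ns"] ev evj set_del_nth_subset[of j ns] sum_list_del_nth[OF j]
      by auto
    also have "\<dots> \<le> \<Lambda> ^ k * even_wt (ns ! j div 2) * S (del_nth j ns)"
      using even_weight_add_le S_pos[of "del_nth j ns"] by (intro mult_right_mono) auto
    also have "\<dots> = \<Lambda> ^ k * S ns" using S_del_nth[OF j] by simp
    finally have "2 * real (ns ! j) * T ((2 * k + ns ! j) # del_nth j ns) \<le> 2 * real (ns ! j) * (\<Lambda> ^ k * S ns)"
      by (intro mult_left_mono) auto
    then show ?thesis by (simp add: mult_ac)
  qed
  have "T ((2 * k + 2) # ns) = T (Suc (2 * k + 1) # ns)" by simp
  also have "\<dots> = (\<Sum>i\<le>k. T (2 * i # (2 * k - 2 * i) # ns)) + (\<Sum>i<k. T ((2 * i + 1) # (2 * k - (2 * i + 1)) # ns))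
      + real (2 * k + 1) * T (2 * k # ns) + (\<Sum>j<length ns. 2 * real (ns ! j) * T ((2 * k + ns ! j) # del_nth j ns))"
    unfolding loop_equation sum_split_parity_odd by simp
  also have "\<dots> \<le> (\<Sum>i\<le>k. even_wt i * even_wt (k - i) * S ns) + (\<Sum>i<k. \<kappa> * \<Lambda> ^ k * S ns)
      + real (2 * k + 1) * (even_wt k * S ns) + (\<Sum>j<length ns. real (ns ! j) * (2 * \<Lambda> ^ k * S ns))"
    using 1 2 3 4 by (intro add_mono sum_mono mult_left_mono) auto
  also have "\<dots> = ((\<Sum>i\<le>k. even_wt i * even_wt (k - i)) + real k * (\<kappa> * \<Lambda> ^ k)
     + real (2 * k + 1) * even_wt k + 2 * real (sum_list ns) * \<Lambda> ^ k) * S ns"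
  proof -
    have "(\<Sum>j<length ns. real (ns ! j) * (2 * \<Lambda> ^ k * S ns)) = real (sum_list ns) * (2 * \<Lambda> ^ k * S ns)"
      by (simp add: sum_list_sum_nth atLeast0LessThan sum_distrib_right)
    moreover have "(\<Sum>i\<le>k. even_wt i * even_wt (k - i) * S ns) = (\<Sum>i\<le>k. even_wt i * even_wt (k - i)) * S ns"
      by (simp add: sum_distrib_right)
    ultimately show ?thesis by (simp only: distrib_right) simp
  qed
  also have "\<dots> \<le> even_wt (Suc k) * S ns"
    using even_step[OF N] S_pos[of ns] by (intro mult_right_mono) auto
  finally show ?thesis .
qed

text \<open>Splitting an odd trace gives one odd and one even trace, a twist keeps the parity, and
  merging with an even trace leaves an odd one, so two odd traces remain. Merging the two odd traces
  leaves none. Thus the two families of products are closed under the expansion.\<close>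

lemma T_odd_step:
  assumes ev: "\<forall>n\<in>set ns. even n" and N: "2 * i + 2 * j + 2 + sum_list ns \<le> 2 * p" and ji: "j \<le> i"
    and IHe: "\<And>ms. sum_list ms < 2 * i + 2 * j + 2 + sum_list ns \<Longrightarrow> \<forall>n\<in>set ms. even n \<Longrightarrow> T ms \<le> S ms"
    and IHo: "\<And>a b ms. a + b + sum_list ms < 2 * i + 2 * j + 2 + sum_list ns \<Longrightarrow> odd a \<Longrightarrow> odd b \<Longrightarrow>
      \<forall>n\<in>set ms. even n \<Longrightarrow> T (a # b # ms) \<le> \<kappa> * \<Lambda> ^ ((a + b) div 2) * S ms"
  shows "T ((2 * i + 1) # (2 * j + 1) # ns) \<le> \<kappa> * \<Lambda> ^ Suc (i + j) * S ns"
proof -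
  let ?b = "2 * j + 1" and ?q = "\<Lambda> ^ (i + j)"
  have 1: "T (2 * l # (2 * i - 1 - 2 * l) # ?b # ns) \<le> \<kappa> * (\<Lambda> ^ (i + j - l) * even_wt l) * S ns" if "l < i" for l
  proof -
    have "T (2 * l # (2 * i - 1 - 2 * l) # ?b # ns) = T ((2 * i - 1 - 2 * l) # ?b # 2 * l # ns)"
      by (rule T_perm) simp
    also have "\<dots> \<le> \<kappa> * \<Lambda> ^ ((2 * i - 1 - 2 * l + ?b) div 2) * S (2 * l # ns)"
      using that ev by (intro IHo) auto
    also have "(2 * i - 1 - 2 * l + ?b) div 2 = i + j - l" using that by linarith
    finally show ?thesis by (simp add: mult_ac)
  qed
  \<comment> \<open>The mirror image of the previous family: now the second part is the even one,
    and \<open>l\<close> becomes \<open>i - Suc l\<close>.\<close>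
  have 2: "T ((2 * l + 1) # (2 * i - 1 - (2 * l + 1)) # ?b # ns)
      \<le> \<kappa> * (\<Lambda> ^ (i + j - (i - Suc l)) * even_wt (i - Suc l)) * S ns" if "l < i" for l
  proof -
    have "T ((2 * l + 1) # (2 * i - 1 - (2 * l + 1)) # ?b # ns)
        = T (2 * (i - Suc l) # (2 * i - 1 - 2 * (i - Suc l)) # ?b # ns)"
      using that by (intro T_perm) (auto simp: diff_mult_distrib2)
    then show ?thesis using 1[of "i - Suc l"] that by simp
  qed
  have 3: "real (2 * i) * T ((2 * i - 1) # ?b # ns) \<le> real (2 * i) * (\<kappa> * ?q * S ns)"
  proof (cases i)
    case (Suc i')
    then have "T ((2 * i - 1) # ?b # ns) \<le> \<kappa> * \<Lambda> ^ ((2 * i - 1 + ?b) div 2) * S ns"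
      using ev by (intro IHo) auto
    also have "(2 * i - 1 + ?b) div 2 = i + j" using Suc by linarith
    finally show ?thesis by (intro mult_left_mono) auto
  qed simp
  have 4: "T ((2 * i + ?b - 1) # ns) \<le> even_wt (i + j) * S ns"
    using IHe[of "(2 * i + ?b - 1) # ns"] ev by simp
  have 5: "2 * real (ns ! l) * T ((2 * i + ns ! l - 1) # ?b # del_nth l ns) \<le> real (ns ! l) * (2 * \<kappa> * ?q * S ns)"
    if l: "l < length ns" for l
  \<comment> \<open>A trace of order 0 has coefficient 0; otherwise its order is at least 2 and the
    subtraction is not truncated.\<close>
  proof (cases "ns ! l = 0")
    case False
    have "even (ns ! l)" using ev l by auto
    then obtain h where h: "ns ! l = 2 * h" by blast
    have h0: "h \<noteq> 0" using h False by auto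
    have "T ((2 * i + ns ! l - 1) # ?b # del_nth l ns)
        \<le> \<kappa> * \<Lambda> ^ ((2 * i + ns ! l - 1 + ?b) div 2) * S (del_nth l ns)"
      using h h0 ev set_del_nth_subset[of l ns] sum_list_del_nth[OF l] by (intro IHo) auto
    also have "(2 * i + ns ! l - 1 + ?b) div 2 = i + j + h" using h h0 by linarith
    also have "\<kappa> * \<Lambda> ^ (i + j + h) * S (del_nth l ns) \<le> \<kappa> * (?q * even_wt h) * S (del_nth l ns)"
      unfolding power_add[of _ "i + j"]
      using \<kappa> \<Lambda>_pos power_le_even_weight[of h] S_pos[of "del_nth l ns"]
      by (intro mult_right_mono mult_left_mono) auto
    also have "\<dots> = \<kappa> * ?q * S ns" using S_del_nth[OF l] h by simp
    finally have "2 * real (ns ! l) * T ((2 * i + ns ! l - 1) # ?b # del_nth l ns)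
        \<le> 2 * real (ns ! l) * (\<kappa> * ?q * S ns)" by (intro mult_left_mono) auto
    then show ?thesis by (simp add: mult_ac)
  qed simp
  have join: "(\<Sum>l<length (?b # ns). 2 * real ((?b # ns) ! l) * T ((2 * i + (?b # ns) ! l - 1) # del_nth l (?b # ns)))
      = 2 * real ?b * T ((2 * i + ?b - 1) # ns)
         + (\<Sum>l<length ns. 2 * real (ns ! l) * T ((2 * i + ns ! l - 1) # ?b # del_nth l ns))"
    unfolding list.size(4) add_0_right add_Suc_right by (subst sum.lessThan_Suc_shift) simp
  have "T ((2 * i + 1) # ?b # ns) = T (Suc (2 * i) # ?b # ns)" by simp
  also have "\<dots> = (\<Sum>l<i. T (2 * l # (2 * i - 1 - 2 * l) # ?b # ns))
      + (\<Sum>l<i. T ((2 * l + 1) # (2 * i - 1 - (2 * l + 1)) # ?b # ns))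
      + real (2 * i) * T ((2 * i - 1) # ?b # ns)
      + (2 * real ?b * T ((2 * i + ?b - 1) # ns)
         + (\<Sum>l<length ns. 2 * real (ns ! l) * T ((2 * i + ns ! l - 1) # ?b # del_nth l ns)))"
    unfolding loop_equation sum_split_parity join ..
  also have "\<dots> \<le> (\<Sum>l<i. \<kappa> * (\<Lambda> ^ (i + j - l) * even_wt l) * S ns)
      + (\<Sum>l<i. \<kappa> * (\<Lambda> ^ (i + j - (i - Suc l)) * even_wt (i - Suc l)) * S ns)
      + real (2 * i) * (\<kappa> * ?q * S ns)
      + (2 * real ?b * (even_wt (i + j) * S ns) + (\<Sum>l<length ns. real (ns ! l) * (2 * \<kappa> * ?q * S ns)))"
    by (intro add_mono sum_mono 1 2 3 5 mult_left_mono[OF 4]) auto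
  also have "(\<Sum>l<i. \<kappa> * (\<Lambda> ^ (i + j - (i - Suc l)) * even_wt (i - Suc l)) * S ns)
      = (\<Sum>l<i. \<kappa> * (\<Lambda> ^ (i + j - l) * even_wt l) * S ns)"
    by (rule sum.nat_diff_reindex)
  also have "(\<Sum>l<i. \<kappa> * (\<Lambda> ^ (i + j - l) * even_wt l) * S ns)
      = \<kappa> * (\<Sum>l<i. \<Lambda> ^ (i + j - l) * even_wt l) * S ns"
    by (simp add: sum_distrib_left sum_distrib_right)
  also have "(\<Sum>l<length ns. real (ns ! l) * (2 * \<kappa> * ?q * S ns)) = real (sum_list ns) * (2 * \<kappa> * ?q * S ns)"
    by (simp add: sum_list_sum_nth atLeast0LessThan sum_distrib_right)
  also have "\<kappa> * (\<Sum>l<i. \<Lambda> ^ (i + j - l) * even_wt l) * S ns + \<kappa> * (\<Sum>l<i. \<Lambda> ^ (i + j - l) * even_wt l) * S ns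
      + real (2 * i) * (\<kappa> * ?q * S ns)
      + (2 * real ?b * (even_wt (i + j) * S ns) + real (sum_list ns) * (2 * \<kappa> * ?q * S ns))
    = (2 * \<kappa> * (\<Sum>l<i. \<Lambda> ^ (i + j - l) * even_wt l) + 2 * real i * (\<kappa> * ?q)
     + 2 * real ?b * even_wt (i + j) + 2 * real (sum_list ns) * (\<kappa> * ?q)) * S ns"
    by (simp add: algebra_simps)
  also have "\<dots> \<le> \<kappa> * \<Lambda> ^ Suc (i + j) * S ns"
    using odd_step[OF ji N] S_pos[of ns] by (intro mult_right_mono) auto
  finally show ?thesis .
qed

text \<open>Both families are treated together because each expansion can lead into the other. The
  cap \<open>2 * p\<close> on the degree is what the constants of the locale were fitted to.\<close>

lemma T_le_weights:
  "(\<forall>ns. sum_list ns = N \<longrightarrow> (\<forall>n\<in>set ns. even n) \<longrightarrow> T ns \<le> S ns) \<and>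
   (\<forall>a b ns. a + b + sum_list ns = N \<longrightarrow> odd a \<longrightarrow> odd b \<longrightarrow> (\<forall>n\<in>set ns. even n) \<longrightarrow>
      T (a # b # ns) \<le> \<kappa> * \<Lambda> ^ ((a + b) div 2) * S ns)"
  if "N \<le> 2 * p"
  using that
proof (induction N rule: less_induct)
  case (less N)
  have IHe: "T ms \<le> S ms" if "sum_list ms < N" "\<forall>n\<in>set ms. even n" for ms
    using less.IH[of "sum_list ms"] less.prems that by simp
  have IHo: "T (a # b # ms) \<le> \<kappa> * \<Lambda> ^ ((a + b) div 2) * S ms"
    if "a + b + sum_list ms < N" "odd a" "odd b" "\<forall>n\<in>set ms. even n" for a b ms
    using less.IH[of "a + b + sum_list ms"] less.prems that by simp
  show ?case
  proof (intro conjI allI impI)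
    fix ns assume N: "sum_list ns = N" and ev: "\<forall>n\<in>set ns. even n"
    show "T ns \<le> S ns"
    proof (cases "\<forall>n\<in>set ns. n = 0")
      case True
      then show ?thesis using T_zeros S_zeros by simp
    next
      case False
      then obtain n where n: "n \<in> set ns" "n \<noteq> 0" by blast
      then obtain us vs where ns: "ns = us @ n # vs" by (meson split_list)
      obtain k where k: "n = 2 * k + 2"
      proof -
        obtain k' where "n = 2 * k'" using ev n by blast
        then show ?thesis using n that[of "k' - 1"] by (cases k') auto
      qed
      have perm: "mset ns = mset (n # us @ vs)" by (simp add: ns)
      have sum: "2 * k + 2 + sum_list (us @ vs) = N" using N by (simp add: ns k)
      have "T ((2 * k + 2) # us @ vs) \<le> even_wt (Suc k) * S (us @ vs)"
        using ev less.prems sum IHe IHo by (intro T_even_step) (auto simp: ns)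
      then show ?thesis using T_perm[OF perm] S_perm[OF perm] k by simp
    qed
  next
    fix a b ns assume N: "a + b + sum_list ns = N" and odd: "odd a" "odd b" and ev: "\<forall>n\<in>set ns. even n"
    have *: "T ((2 * i + 1) # (2 * j + 1) # ns) \<le> \<kappa> * \<Lambda> ^ Suc (i + j) * S ns"
      if "j \<le> i" "2 * i + 2 * j + 2 + sum_list ns = N" for i j
      using that ev less.prems IHe IHo by (intro T_odd_step) auto
    obtain i j where ij: "a = 2 * i + 1" "b = 2 * j + 1" using odd by (meson oddE)
    have swap: "T ((2 * j + 1) # (2 * i + 1) # ns) = T ((2 * i + 1) # (2 * j + 1) # ns)" by (rule T_perm) simp
    have e: "(a + b) div 2 = Suc (i + j)" using ij by simp
    have "T ((2 * i + 1) # (2 * j + 1) # ns) \<le> \<kappa> * \<Lambda> ^ Suc (i + j) * S ns"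
    proof (cases "j \<le> i")
      case True
      then show ?thesis using *[of j i] N ij by simp
    next
      case False
      then show ?thesis using *[of i j] N ij swap by (simp add: add.commute)
    qed
    then show "T (a # b # ns) \<le> \<kappa> * \<Lambda> ^ ((a + b) div 2) * S ns" unfolding e unfolding ij .
  qed
qed

lemma expectation_trace_le: "expectation (\<lambda>\<omega>. tr (2 * p) \<omega>) \<le> even_wt p"
  using T_le_weights[of "2 * p"] by (auto simp: T_def dest!: spec[of _ "[2 * p]"])

end

text \<open>The Joukowski parametrisation \<open>l = t + y / t\<close> makes \<open>l / t\<close> the value at \<open>y / l ^ 2\<close> of the
  Catalan generating function.\<close>

lemma (in goe) expectation_trace_le_power:
  assumes p: "1 \<le> p" and r: "2 \<le> r"
  shows "expectation (\<lambda>\<omega>. tr (2 * p) \<omega>) \<le> real r * (2 * sqrt (real r + real p) + 2 * sqrt (real p)) ^ (2 * p)"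
proof -
  \<comment> \<open>The value of \<open>t\<close> makes t^2 exceed y by exactly 4 sqrt (y p) + 4 p,
    while y / t \<le> sqrt y keeps \<open>l\<close> below 2 sqrt y + 2 sqrt p. The value of \<kappa>
    is fixed by \<kappa> p = 4 sqrt (y p), which fits the even condition; in the odd one, \<kappa>
    times the slack 4 sqrt (y p) is 16 y and covers the term 2 r.\<close>
  define y t l \<kappa> where "y = real r + real p" and "t = sqrt y + 2 * sqrt (real p)"
    and "l = t + y / t" and "\<kappa> = 4 * sqrt (y / real p)"
  have pos: "0 < real p" "0 < y" "0 < sqrt y" "0 < sqrt (real p)" using p by (auto simp: y_def)
  then have t: "0 < t" "sqrt y \<le> t" by (auto simp: t_def intro: add_pos_pos)
  have y2: "sqrt y * sqrt y = y" and p2: "sqrt (real p) * sqrt (real p) = real p" using pos by auto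
  have l: "0 < l" unfolding l_def using t pos by (intro add_pos_pos divide_pos_pos)
  have l_le: "l \<le> 2 * sqrt y + 2 * sqrt (real p)"
  proof -
    have "y \<le> sqrt y * t" using mult_left_mono[OF t(2), of "sqrt y"] pos y2 by simp
    then have "y / t \<le> sqrt y" using t by (simp add: pos_divide_le_eq)
    then show ?thesis by (simp add: l_def t_def)
  qed
  have l2: "l\<^sup>2 = t\<^sup>2 + 2 * y + (y / t)\<^sup>2" using t by (simp add: l_def power2_eq_square field_simps)
  have t2: "t\<^sup>2 = y + 4 * sqrt (y * real p) + 4 * real p"
  proof -
    have "t\<^sup>2 = sqrt y * sqrt y + 4 * (sqrt y * sqrt (real p)) + 4 * (sqrt (real p) * sqrt (real p))"
      by (simp only: t_def power2_eq_square distrib_left distrib_right) simp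
    then show ?thesis unfolding y2 p2 by (simp add: real_sqrt_mult)
  qed
  have \<kappa>p: "\<kappa> * real p = 4 * sqrt (y * real p)"
  proof -
    have "sqrt (y / real p) * real p = sqrt (y * real p)"
      using pos p2 by (simp add: real_sqrt_divide real_sqrt_mult field_simps)
    then show ?thesis by (simp add: \<kappa>_def)
  qed
  have yp: "1 \<le> sqrt (y / real p)" using p by (simp add: y_def)
  have gap: "2 * y * (l / t) + 4 * sqrt (y * real p) + 4 * real p \<le> l\<^sup>2"
  proof -
    have "(y / t)\<^sup>2 \<le> y"
    proof -
      have "y\<^sup>2 = y * (sqrt y)\<^sup>2" using pos by (simp add: power2_eq_square)
      also have "\<dots> \<le> y * t\<^sup>2" using t pos by (intro mult_left_mono power_mono) auto
      finally show ?thesis using t by (simp add: power_divide divide_le_eq)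
    qed
    moreover have "y * (l / t) = y + (y / t)\<^sup>2" using t by (simp add: l_def field_simps power2_eq_square)
    ultimately show ?thesis using l2 t2 by linarith
  qed
  have lt: "0 \<le> l / t" using l t by simp
  interpret goe_supersolution M Y r p y "l\<^sup>2" \<kappa> "l / t"
  proof
    show "1 \<le> p" "0 < real r" "y = real r + real p" using p r by (auto simp: y_def)
    show "1 \<le> \<kappa>" unfolding \<kappa>_def using yp by linarith
    show "(\<Sum>i<k. catalan i * (y / l\<^sup>2) ^ i) \<le> l / t" for k
    proof (rule catalan_series_le)
      have "1 + y / l\<^sup>2 * (l / t)\<^sup>2 = 1 + y / t\<^sup>2" using l by (simp add: power_divide)
      also have "\<dots> = l / t" using t by (simp add: l_def field_simps power2_eq_square)
      finally show "1 + y / l\<^sup>2 * (l / t)\<^sup>2 \<le> l / t" by simp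
    qed (use pos in simp)
    have "l\<^sup>2 = 4 * y + (t - y / t)\<^sup>2" using t by (simp add: l_def power2_eq_square field_simps)
    then show "4 * y \<le> l\<^sup>2" by simp
    have xy: "2 * real r * (l / t) \<le> 2 * y * (l / t)"
      using lt by (intro mult_right_mono) (auto simp: y_def)
    show "2 * real r * (l / t) + (3 + \<kappa>) * real p \<le> l\<^sup>2"
      using gap xy \<kappa>p pos by (simp add: algebra_simps)
    have "2 * real r \<le> \<kappa> * (4 * sqrt (y * real p))"
    proof -
      have "\<kappa> * (4 * sqrt (y * real p)) = 16 * (sqrt (y / real p) * sqrt (y * real p))" by (simp add: \<kappa>_def)
      also have "\<dots> = 16 * y" using pos by (simp add: real_sqrt_mult[symmetric])
      finally show ?thesis by (simp add: y_def)
    qed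
    moreover have "\<kappa> * (2 * real r * (l / t) + 4 * real p + 4 * sqrt (y * real p)) \<le> \<kappa> * l\<^sup>2"
      using gap xy yp by (intro mult_left_mono) (auto simp: \<kappa>_def)
    ultimately show "\<kappa> * (2 * real r * (l / t) + 4 * real p) + 2 * real r \<le> \<kappa> * l\<^sup>2"
      by (simp add: algebra_simps)
  qed
  \<comment> \<open>Each of the two summands of \<open>even_wt p\<close> is at most half of the
    target: the Catalan one since \<open>p \<ge> 1\<close>, the other since
    \<open>r \<ge> 2\<close>.\<close>
  have half: "2 * (y ^ p * catalan p) \<le> (l\<^sup>2) ^ p"
  proof -
    have "2 * catalan p \<le> real (p + 1) * catalan p" using p catalan_pos[of p] by (intro mult_right_mono) auto
    also have "\<dots> \<le> 4 ^ p" by (rule catalan_le)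
    finally have "y ^ p * (2 * catalan p) \<le> y ^ p * 4 ^ p" using pos by (intro mult_left_mono) auto
    also have "\<dots> = (4 * y) ^ p" by (simp add: power_mult_distrib)
    also have "\<dots> \<le> (l\<^sup>2) ^ p" using \<Lambda>y pos by (intro power_mono) auto
    finally show ?thesis by (simp add: mult_ac)
  qed
  have "real r * (2 * (y ^ p * catalan p)) \<le> real r * (l\<^sup>2) ^ p" using half by (intro mult_left_mono) auto
  moreover have "2 * (l\<^sup>2) ^ p \<le> real r * (l\<^sup>2) ^ p" using r by (intro mult_right_mono) auto
  ultimately have "even_wt p \<le> real r * (l\<^sup>2) ^ p" by (simp add: even_weight_def)
  also have "(l\<^sup>2) ^ p = l ^ (2 * p)" by (simp add: power_mult)
  also have "real r * l ^ (2 * p) \<le> real r * (2 * sqrt y + 2 * sqrt (real p)) ^ (2 * p)"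
    using l l_le by (intro mult_left_mono power_mono) auto
  finally show ?thesis using expectation_trace_le by (simp add: y_def)
qed

section \<open>The norm of the Gaussian matrix\<close>

text \<open>Only two expectations are compared, so Y may live on a product space of its own,
  unrelated to the space that carries X.\<close>

lemma goe_exists:
  assumes "0 < r"
  shows "\<exists>(M :: (nat \<times> nat \<Rightarrow> real) measure) Y. goe M Y r"
proof -
  let ?N = "density lborel (\<lambda>x. ennreal (std_normal_density x))"
  define K where "K = {(i, j). j \<le> i \<and> i < r}"
  define M where "M = (\<Pi>\<^sub>M k\<in>K. ?N)"
  have "K \<subseteq> {..<r} \<times> {..<r}" by (auto simp: K_def)
  then have finK: "finite K" by (rule finite_subset) simp
  have K0: "K \<noteq> {}" using assms by (auto simp: K_def)
  have pN: "prob_space ?N" by (rule prob_space_normal_density) simp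
  interpret prob_space M unfolding M_def by (intro prob_space_PiM pN)
  have comp: "distr M ?N (\<lambda>\<omega>. \<omega> k) = ?N" if "k \<in> K" for k
    unfolding M_def by (rule distr_PiM_component[OF pN that])
  have meas: "(\<lambda>\<omega>. \<omega> k) \<in> borel_measurable M" if "k \<in> K" for k
    using measurable_component_singleton[OF that, of "\<lambda>_. ?N"] by (simp add: M_def)
  have dist: "distributed M lborel (\<lambda>\<omega>. \<omega> k) std_normal_density" if "k \<in> K" for k
    unfolding distributed_def
  proof (intro conjI)
    have "distr M lborel (\<lambda>\<omega>. \<omega> k) = distr M ?N (\<lambda>\<omega>. \<omega> k)" by (rule distr_cong) auto
    then show "distr M lborel (\<lambda>\<omega>. \<omega> k) = ?N" using comp[OF that] by simp
  qed (use meas[OF that] in auto)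
  have ind: "indep_vars (\<lambda>_. borel) (\<lambda>k \<omega>. \<omega> k) K"
  proof (subst indep_vars_iff_distr_eq_PiM'[OF K0 meas])
    have sets_eq: "sets (\<Pi>\<^sub>M k\<in>K. (borel :: real measure)) = sets M"
      unfolding M_def by (rule sets_PiM_cong) auto
    have "distr M (\<Pi>\<^sub>M k\<in>K. borel) (\<lambda>x. \<lambda>k\<in>K. x k) = distr M M (\<lambda>x. x)"
      by (rule distr_cong) (auto simp: sets_eq M_def space_PiM)
    also have "\<dots> = M" by simp
    also have "M = (\<Pi>\<^sub>M k\<in>K. distr M borel (\<lambda>\<omega>. \<omega> k))"
    proof -
      have "distr M borel (\<lambda>\<omega>. \<omega> k) = ?N" if "k \<in> K" for k
      proof -
        have "distr M borel (\<lambda>\<omega>. \<omega> k) = distr M ?N (\<lambda>\<omega>. \<omega> k)" by (rule distr_cong) auto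
        then show ?thesis using comp[OF that] by simp
      qed
      then show ?thesis by (subst M_def) (intro PiM_cong refl, simp)
    qed
    finally show "distr M (\<Pi>\<^sub>M k\<in>K. borel) (\<lambda>x. \<lambda>k\<in>K. x k) = (\<Pi>\<^sub>M k\<in>K. distr M borel (\<lambda>\<omega>. \<omega> k))" .
  qed simp
  \<comment> \<open>The factor sqrt 2 gives diagonal entries variance 2, as \<open>goe_cov\<close>
    requires.\<close>
  define s where "s e = (if fst e = snd e then sqrt 2 else 1)" for e :: "nat \<times> nat"
  define Y where "Y a b \<omega> = s (a, b) * \<omega> (canonical_edge (a, b))" for a b and \<omega> :: "nat \<times> nat \<Rightarrow> real"
  have cov: "s e * s f * of_bool (canonical_edge e = canonical_edge f) = goe_cov e f" for e f
  proof (cases e; cases f)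
    fix a b c d assume "e = (a, b)" "f = (c, d)"
    then show ?thesis
      by (cases "a = b"; cases "c = d") (auto simp: s_def goe_cov_def canonical_edge_eq_iff)
  qed
  have "goe M Y r"
  proof
    show "Y a b \<omega> = Y b a \<omega>" for a b \<omega>
      by (auto simp: Y_def s_def canonical_edge_def max.commute min.commute)
    fix L :: "(nat \<times> nat) list" assume "set L \<subseteq> {..<r} \<times> {..<r}"
    then have "canonical_edge ` set L \<subseteq> K" by (auto simp: K_def canonical_edge_def)
    note * = wick_formula[OF finK ind dist this, of s]
    show "integrable M (\<lambda>\<omega>. \<Prod>e\<leftarrow>L. Y (fst e) (snd e) \<omega>)"
      using *(1) by (simp add: Y_def)
    show "expectation (\<lambda>\<omega>. \<Prod>e\<leftarrow>L. Y (fst e) (snd e) \<omega>) = wick goe_cov L"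
      using *(2) by (simp add: Y_def cov)
  qed
  then show ?thesis by blast
qed

lemma (in goe) expectation_trace_eq: "expectation (\<lambda>\<omega>. tr m \<omega>) = (\<Sum>v\<in>closed_walks {..<r} m. shape_coeff v)"
proof -
  have sub: "set (edges v) \<subseteq> {..<r} \<times> {..<r}" if "v \<in> closed_walks {..<r} m" for v
    using that set_edges_subset[of v] by (auto simp: closed_walks_def)
  have "expectation (\<lambda>\<omega>. tr m \<omega>) = (\<Sum>v\<in>closed_walks {..<r} m. expectation (mon (edges v)))"
    unfolding trace_power_eq_sum_closed_walks[OF finite_lessThan]
    by (intro Bochner_Integration.integral_sum integrable_monomial sub)
  also have "\<dots> = (\<Sum>v\<in>closed_walks {..<r} m. shape_coeff v)"
    unfolding shape_coeff_def by (intro sum.cong refl expectation_monomial sub)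
  finally show ?thesis .
qed

section \<open>Moments of the given matrix\<close>

locale gauss_matrix = prob_space M for M :: "'a measure" +
  fixes g :: "'n::{finite,linorder} \<Rightarrow> 'n \<Rightarrow> 'a \<Rightarrow> real"
  assumes dist: "\<And>i j. j \<le> i \<Longrightarrow> distributed M lborel (g i j) std_normal_density"
    and indep: "indep_vars (\<lambda>_. borel) (\<lambda>(i, j). g i j) {(i, j). j \<le> i}"
begin

abbreviation X :: "('n \<Rightarrow> 'n \<Rightarrow> real) \<Rightarrow> 'a \<Rightarrow> 'n \<Rightarrow> 'n \<Rightarrow> real" where
  "X b \<omega> i j \<equiv> gauss_sym_matrix g b \<omega> $ i $ j"

lemma X_sym: "X b \<omega> i j = X b \<omega> j i"
  by (auto simp: gauss_sym_matrix_def)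

lemma X_eq:
  assumes "\<And>i j. b i j = b j i"
  shows "X b \<omega> (fst e) (snd e) = b (fst e) (snd e) * (\<lambda>(i, j). g i j) (canonical_edge e) \<omega>"
  using assms[of "fst e" "snd e"] by (auto simp: gauss_sym_matrix_def canonical_edge_def max_def min_def)

lemma monomial:
  assumes "\<And>i j. b i j = b j i"
  shows "integrable M (\<lambda>\<omega>. \<Prod>e\<leftarrow>L. X b \<omega> (fst e) (snd e))"
    and "expectation (\<lambda>\<omega>. \<Prod>e\<leftarrow>L. X b \<omega> (fst e) (snd e))
      = wick (\<lambda>e f. b (fst e) (snd e) * b (fst f) (snd f) * of_bool (canonical_edge e = canonical_edge f)) L"
proof -
  have "canonical_edge ` set L \<subseteq> {(i, j). j \<le> i}"
    by (auto simp: canonical_edge_def intro: order_trans[OF min.cobounded1 max.cobounded1])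
  note * = wick_formula[OF _ indep _ this, of "\<lambda>e. b (fst e) (snd e)"]
  show "integrable M (\<lambda>\<omega>. \<Prod>e\<leftarrow>L. X b \<omega> (fst e) (snd e))"
    unfolding X_eq[OF assms] using dist by (intro *(1)) auto
  show "expectation (\<lambda>\<omega>. \<Prod>e\<leftarrow>L. X b \<omega> (fst e) (snd e))
      = wick (\<lambda>e f. b (fst e) (snd e) * b (fst f) (snd f) * of_bool (canonical_edge e = canonical_edge f)) L"
    unfolding X_eq[OF assms] using dist by (intro *(2)) auto
qed

lemma integrable_trace:
  assumes "\<And>i j. b i j = b j i"
  shows "integrable M (\<lambda>\<omega>. trace_power UNIV (X b \<omega>) m)"
  unfolding trace_power_eq_sum_closed_walks[OF finite]
  by (intro Bochner_Integration.integrable_sum monomial(1) assms)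

lemma expectation_trace_le_goe:
  assumes b_sym: "\<And>i j. b i j = b j i" and b1: "\<And>i j. \<bar>b i j\<bar> \<le> 1"
    and s: "\<And>i. (\<Sum>j\<in>UNIV. (b i j)\<^sup>2) \<le> s\<^sup>2" and r: "s\<^sup>2 + real p \<le> real r" "0 < r"
  shows "expectation (\<lambda>\<omega>. trace_power UNIV (X b \<omega>) (2 * p))
      \<le> real CARD('n) / real r * (\<Sum>v\<in>closed_walks {..<r} (2 * p). shape_coeff v)"
proof -
  let ?b = "\<lambda>e. b (fst e) (snd e)" and ?W = "closed_walks (UNIV :: 'n set) (2 * p)"
  have b_can: "?b (canonical_edge e) = ?b e" for e
    using b_sym[of "fst e" "snd e"] by (auto simp: canonical_edge_def max_def min_def)
  have walk: "expectation (\<lambda>\<omega>. \<Prod>e\<leftarrow>edges w. X b \<omega> (fst e) (snd e))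
      \<le> shape_coeff w * (\<Prod>e\<in>tree_edges w. (?b e)\<^sup>2)" for w
  proof -
    let ?w = "wick (\<lambda>e f. of_bool (canonical_edge e = canonical_edge f)) (edges w)"
    have w: "0 \<le> ?w" "?w \<le> shape_coeff w"
      using wick_mono[of "edges w" "\<lambda>e f. of_bool (canonical_edge e = canonical_edge f)" goe_cov]
      by (auto simp: of_bool_can_le_goe_cov shape_coeff_def)
    have "expectation (\<lambda>\<omega>. \<Prod>e\<leftarrow>edges w. X b \<omega> (fst e) (snd e)) = prod_list (map ?b (edges w)) * ?w"
      unfolding monomial(2)[OF b_sym] by (rule wick_scale)
    also have "\<dots> \<le> \<bar>prod_list (map ?b (edges w))\<bar> * ?w" using w by (intro mult_right_mono) auto
    also have "\<bar>prod_list (map ?b (edges w))\<bar> = (\<Prod>e\<leftarrow>edges w. \<bar>?b e\<bar>)"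
    proof -
      have "\<bar>prod_list (map ?b L)\<bar> = (\<Prod>e\<leftarrow>L. \<bar>?b e\<bar>)" for L
        by (induction L) (auto simp: abs_mult)
      then show ?thesis .
    qed
    also have "(\<Prod>e\<leftarrow>edges w. \<bar>?b e\<bar>) * ?w \<le> shape_coeff w * (\<Prod>e\<in>tree_edges w. (?b e)\<^sup>2)"
    proof (cases "shape_coeff w = 0")
      case True
      then show ?thesis using w by simp
    next
      case False
      have "(\<Prod>e\<leftarrow>edges w. \<bar>?b e\<bar>) \<le> (\<Prod>e\<in>tree_edges w. (?b e)\<^sup>2)"
        using False b1 b_can by (intro prod_edges_le) auto
      then have "(\<Prod>e\<leftarrow>edges w. \<bar>?b e\<bar>) * ?w \<le> (\<Prod>e\<in>tree_edges w. (?b e)\<^sup>2) * shape_coeff w"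
        using w by (intro mult_mono) (auto intro!: prod_nonneg)
      then show ?thesis by (simp add: mult.commute)
    qed
    finally show ?thesis .
  qed
  have "expectation (\<lambda>\<omega>. trace_power UNIV (X b \<omega>) (2 * p))
      = (\<Sum>w\<in>?W. expectation (\<lambda>\<omega>. \<Prod>e\<leftarrow>edges w. X b \<omega> (fst e) (snd e)))"
    unfolding trace_power_eq_sum_closed_walks[OF finite]
    by (intro Bochner_Integration.integral_sum monomial(1) b_sym)
  also have "\<dots> \<le> (\<Sum>w\<in>?W. shape_coeff w * (\<Prod>e\<in>tree_edges w. (?b e)\<^sup>2))"
    by (intro sum_mono walk)
  also have "\<dots> \<le> real CARD('n) / real r * (\<Sum>v\<in>closed_walks {..<r} (2 * p). shape_coeff v)"
  proof (rule shape_comparison[where s = "s\<^sup>2" and p = p])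
    show "(\<Sum>c\<in>UNIV. (?b (canonical_edge (a, c)))\<^sup>2) \<le> s\<^sup>2" for a
      unfolding b_can using s[of a] by simp
    show "card (set w) \<le> Suc p" if "w \<in> ?W" "shape_coeff w \<noteq> 0" for w
      using that by (intro card_set_le_if_shape_coeff_nonzero) (auto simp: closed_walks_def)
  qed (use r in auto)
  finally show ?thesis .
qed

lemma expectation_trace_le:
  assumes b_sym: "\<And>i j. b i j = b j i" and b1: "\<And>i j. \<bar>b i j\<bar> \<le> 1"
    and s: "\<And>i. (\<Sum>j\<in>UNIV. (b i j)\<^sup>2) \<le> s\<^sup>2" and s0: "0 < s" and p: "1 \<le> p"
  shows "expectation (\<lambda>\<omega>. trace_power UNIV (X b \<omega>) (2 * p))
      \<le> real CARD('n) * (2 * s + 6 * sqrt (real p)) ^ (2 * p)"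
proof -
  define r where "r = nat \<lceil>s\<^sup>2\<rceil> + p"
  have "0 < s\<^sup>2" using s0 by simp
  then have c: "1 \<le> nat \<lceil>s\<^sup>2\<rceil>" "s\<^sup>2 \<le> real (nat \<lceil>s\<^sup>2\<rceil>)" "real (nat \<lceil>s\<^sup>2\<rceil>) \<le> s\<^sup>2 + 1"
    by linarith+
  have r: "2 \<le> r" "s\<^sup>2 + real p \<le> real r" "real r \<le> s\<^sup>2 + 1 + real p" using c p by (auto simp: r_def)
  obtain N Y where "goe (N :: (nat \<times> nat \<Rightarrow> real) measure) Y r" using goe_exists[of r] r by auto
  then interpret G: goe N Y r .
  have "expectation (\<lambda>\<omega>. trace_power UNIV (X b \<omega>) (2 * p))
      \<le> real CARD('n) / real r * (\<Sum>v\<in>closed_walks {..<r} (2 * p). shape_coeff v)"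
    using b_sym b1 s r by (intro expectation_trace_le_goe) auto
  also have "\<dots> \<le> real CARD('n) / real r * (real r * (2 * sqrt (real r + real p) + 2 * sqrt (real p)) ^ (2 * p))"
    using G.expectation_trace_le_power[OF p r(1)]
    by (intro mult_left_mono) (auto simp: G.expectation_trace_eq)
  also have "\<dots> = real CARD('n) * (2 * sqrt (real r + real p) + 2 * sqrt (real p)) ^ (2 * p)"
    using r by simp
  also have "\<dots> \<le> real CARD('n) * (2 * s + 6 * sqrt (real p)) ^ (2 * p)"
  proof -
    \<comment> \<open>The left side is at most s^2 + 1 + 2 p, and \<open>p \<ge> 1\<close> bounds
      this by s^2 + 4 p.\<close>
    have "real r + real p \<le> (s + 2 * sqrt (real p))\<^sup>2"
    proof -
      have "(s + 2 * sqrt (real p))\<^sup>2 = s\<^sup>2 + 4 * (s * sqrt (real p)) + 4 * real p"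
        by (simp add: power2_sum power_mult_distrib)
      moreover have "0 \<le> s * sqrt (real p)" using s0 by simp
      ultimately show ?thesis using r p by linarith
    qed
    then have "sqrt (real r + real p) \<le> s + 2 * sqrt (real p)" using s0 by (intro real_le_lsqrt) auto
    then show ?thesis by (intro mult_left_mono power_mono) auto
  qed
  finally show ?thesis .
qed

section \<open>Integrability, and from moments to the expected norm\<close>

lemma X_measurable: "(\<lambda>\<omega>. X b \<omega> i j) \<in> borel_measurable M"
proof -
  have "g i j \<in> borel_measurable M" if "j \<le> i" for i j
    using distributed_measurable[OF dist[OF that]] by simp
  then show ?thesis by (cases "j \<le> i") (auto simp: gauss_sym_matrix_def)
qed

lemma spec_norm_measurable: "(\<lambda>\<omega>. spec_norm (gauss_sym_matrix g b \<omega>)) \<in> borel_measurable M"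
proof -
  have "gauss_sym_matrix g b \<in> borel_measurable M"
    by (subst borel_measurable_euclidean_space)
       (auto simp: Basis_vec_def inner_axis intro: X_measurable)
  then show ?thesis
    by (rule borel_measurable_continuous_on[OF continuous_on_spec_norm])
qed

lemma integrable_spec_norm_power:
  assumes "\<And>i j. b i j = b j i" "1 \<le> p"
  shows "integrable M (\<lambda>\<omega>. spec_norm (gauss_sym_matrix g b \<omega>) ^ (2 * p))"
    and "expectation (\<lambda>\<omega>. spec_norm (gauss_sym_matrix g b \<omega>) ^ (2 * p)) \<le> expectation (\<lambda>\<omega>. trace_power UNIV (X b \<omega>) (2 * p))"
proof -
  have le: "spec_norm (gauss_sym_matrix g b \<omega>) ^ (2 * p) \<le> trace_power UNIV (X b \<omega>) (2 * p)" for \<omega>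
    using assms(2) X_sym by (intro spec_norm_power_le_trace) auto
  show i: "integrable M (\<lambda>\<omega>. spec_norm (gauss_sym_matrix g b \<omega>) ^ (2 * p))"
  proof (rule Bochner_Integration.integrable_bound[OF integrable_trace[OF assms(1), where m = "2 * p"]])
    show "(\<lambda>\<omega>. spec_norm (gauss_sym_matrix g b \<omega>) ^ (2 * p)) \<in> borel_measurable M"
      by (intro borel_measurable_power spec_norm_measurable)
    have "norm (spec_norm (gauss_sym_matrix g b \<omega>) ^ (2 * p)) \<le> norm (trace_power UNIV (X b \<omega>) (2 * p))" for \<omega>
      using le[of \<omega>] zero_le_power[OF spec_norm_nonneg, of "gauss_sym_matrix g b \<omega>" "2 * p"] by simp
    then show "AE \<omega> in M. norm (spec_norm (gauss_sym_matrix g b \<omega>) ^ (2 * p)) \<le> norm (trace_power UNIV (X b \<omega>) (2 * p))"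
      by simp
  qed
  show "expectation (\<lambda>\<omega>. spec_norm (gauss_sym_matrix g b \<omega>) ^ (2 * p)) \<le> expectation (\<lambda>\<omega>. trace_power UNIV (X b \<omega>) (2 * p))"
    by (intro integral_mono i integrable_trace assms le)
qed

lemma integrable_spec_norm:
  assumes "\<And>i j. b i j = b j i"
  shows "integrable M (\<lambda>\<omega>. spec_norm (gauss_sym_matrix g b \<omega>))"
  using square_integrable_imp_integrable[OF spec_norm_measurable[of b]] integrable_spec_norm_power(1)[of b 1] assms
  by simp

lemma expectation_spec_norm_le:
  assumes "\<And>i j. b i j = b j i" "1 \<le> p" "0 \<le> C"
    and "expectation (\<lambda>\<omega>. trace_power UNIV (X b \<omega>) (2 * p)) \<le> C ^ (2 * p)"
  shows "expectation (\<lambda>\<omega>. spec_norm (gauss_sym_matrix g b \<omega>)) \<le> C"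
proof -
  let ?Z = "\<lambda>\<omega>. spec_norm (gauss_sym_matrix g b \<omega>)"
  have "expectation ?Z ^ (2 * p) \<le> expectation (\<lambda>\<omega>. ?Z \<omega> ^ (2 * p))"
    by (rule jensens_inequality[where I = UNIV, OF integrable_spec_norm[OF assms(1)] _ _
          integrable_spec_norm_power(1)[OF assms(1,2)]]) (simp_all add: convex_power_even)
  also have "\<dots> \<le> C ^ (2 * p)"
    using integrable_spec_norm_power(2)[OF assms(1,2)] assms(4) by (rule order_trans)
  finally have "\<not> C ^ (2 * p) < expectation ?Z ^ (2 * p)" by simp
  then show ?thesis using assms(2,3) power_strict_mono[of C "expectation ?Z" "2 * p"] by force
qed

text \<open>Serves dimension one, where ln n = 0 leaves no room for a moment order between 1 and ln
  n / ln (1 + \<epsilon>).\<close>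

lemma expectation_trace_2:
  assumes b_sym: "\<And>i j. b i j = b j i"
  shows "expectation (\<lambda>\<omega>. trace_power UNIV (X b \<omega>) 2) = (\<Sum>i\<in>UNIV. \<Sum>j\<in>UNIV. (b i j)\<^sup>2)"
proof -
  have "trace_power UNIV (X b \<omega>) 2 = (\<Sum>i\<in>UNIV. \<Sum>j\<in>UNIV. (X b \<omega> i j)\<^sup>2)" for \<omega>
    using trace_power_double[where I = "UNIV :: 'n set" and A = "X b \<omega>" and m = 1] X_sym by (simp add: mat_power_1[unfolded One_nat_def] del: mat_power.simps)
  then have "expectation (\<lambda>\<omega>. trace_power UNIV (X b \<omega>) 2) = (\<Sum>i\<in>UNIV. \<Sum>j\<in>UNIV. expectation (\<lambda>\<omega>. (X b \<omega> i j)\<^sup>2))"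
    using monomial(1)[OF b_sym, where L = "[(i, j), (i, j)]" for i j]
    by (simp add: power2_eq_square)
  also have "\<dots> = (\<Sum>i\<in>UNIV. \<Sum>j\<in>UNIV. (b i j)\<^sup>2)"
    using monomial(2)[OF b_sym, where L = "[(i, j), (i, j)]" for i j] by (simp add: power2_eq_square)
  finally show ?thesis .
qed

end

lemma spec_norm_scaleR: "spec_norm (c *\<^sub>R A) = \<bar>c\<bar> * spec_norm (A :: real^'n^'n)"
proof -
  have "(\<lambda>v. (c *\<^sub>R A) *v v) = (\<lambda>v. c *\<^sub>R (A *v v))"
    by (simp add: scaleR_matrix_vector_assoc)
  then show ?thesis
    unfolding spec_norm_def by (simp add: onorm_scaleR linear_conv_bounded_linear[symmetric])
qed

section \<open>Choice of the moment order and conclusion\<close>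

text \<open>The least admissible order is t = ln n / (2 ln (1 + \<epsilon>)) rounded up. Since 1 +
  \<epsilon> \<le> 3/2 \<le> n, t is at least 1/2, and then rounding up at most doubles it.\<close>

lemma moment_order_exists:
  fixes n :: nat and \<epsilon> :: real
  assumes "2 \<le> n" "0 < \<epsilon>" "\<epsilon> \<le> 1 / 2"
  obtains p :: nat where "1 \<le> p" "real n \<le> (1 + \<epsilon>) ^ (2 * p)" "real p \<le> ln (real n) / ln (1 + \<epsilon>)"
proof -
  let ?l = "ln (1 + \<epsilon>)"
  define t where "t = ln (real n) / (2 * ?l)"
  have l: "0 < ?l" using assms by simp
  have "?l \<le> ln (real n)" using assms by simp
  then have t: "1 / 2 \<le> t" using l by (simp add: t_def field_simps)
  define p where "p = nat \<lceil>t\<rceil>"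
  have p: "1 \<le> p" "t \<le> real p" using t unfolding p_def by linarith+
  have p_le: "real p \<le> 2 * t"
  proof (cases "t \<le> 1")
    case True
    then have "\<lceil>t\<rceil> \<le> 1" by (simp add: ceiling_le_iff)
    then have "real p \<le> 1" unfolding p_def by linarith
    then show ?thesis using t by linarith
  next
    case False
    then show ?thesis unfolding p_def by linarith
  qed
  have "ln (real n) = t * (2 * ?l)" using l by (simp add: t_def)
  also have "\<dots> \<le> real p * (2 * ?l)" using p l by (intro mult_right_mono) auto
  also have "\<dots> = ln ((1 + \<epsilon>) ^ (2 * p))" using assms by (simp add: ln_realpow)
  finally have "real n \<le> (1 + \<epsilon>) ^ (2 * p)" using assms by (simp add: ln_le_cancel_iff)
  moreover have "real p \<le> ln (real n) / ?l" using p_le l by (simp add: t_def field_simps)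
  ultimately show ?thesis using that p by blast
qed

theorem theorem1p1:
  fixes M :: "'a measure"
    and g :: "'n::{finite,linorder} \<Rightarrow> 'n \<Rightarrow> 'a \<Rightarrow> real"
    and b :: "'n \<Rightarrow> 'n \<Rightarrow> real"
    and \<epsilon> :: real
  assumes "prob_space M"
    and "\<And>i j. j \<le> i \<Longrightarrow> distributed M lborel (g i j) std_normal_density"
    and "prob_space.indep_vars M (\<lambda>_. borel) (\<lambda>(i,j). g i j) {(i,j). j \<le> i}"
    and b_sym: "\<And>i j. b i j = b j i"
    and "0 < \<epsilon>" and "\<epsilon> \<le> 1/2"
  shows "integrable M (\<lambda>\<omega>. spec_norm (gauss_sym_matrix g b \<omega>)) \<and>
    prob_space.expectation M (\<lambda>\<omega>. spec_norm (gauss_sym_matrix g b \<omega>))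
      \<le> (1 + \<epsilon>) * (2 * (MAX i. sqrt (\<Sum>j\<in>UNIV. (b i j)\<^sup>2))
         + 6 / sqrt (ln (1 + \<epsilon>)) * (MAX p\<in>UNIV. \<bar>b (fst p) (snd p)\<bar>) * sqrt (ln (real CARD('n))))"
proof -
  interpret prob_space M by fact
  interpret gauss_matrix M g using assms(2,3) by unfold_locales
  define \<sigma> where "\<sigma> = (MAX i. sqrt (\<Sum>j\<in>UNIV. (b i j)\<^sup>2))"
  define \<tau> where "\<tau> = (MAX p\<in>UNIV. \<bar>b (fst p) (snd p)\<bar>)"
  let ?n = "CARD('n)" and ?l = "ln (1 + \<epsilon>)"
  have row: "sqrt (\<Sum>j\<in>UNIV. (b i j)\<^sup>2) \<le> \<sigma>" for i
    unfolding \<sigma>_def by (rule Max_ge) auto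
  have entry: "\<bar>b i j\<bar> \<le> \<tau>" for i j
    unfolding \<tau>_def by (intro Max_ge finite_imageI finite range_eqI[of _ _ "(i, j)"]) simp
  have \<sigma>0: "0 \<le> \<sigma>" using row[of undefined] by (rule order_trans[rotated]) (auto intro: sum_nonneg)
  have \<tau>0: "0 \<le> \<tau>" using entry[of undefined undefined] by linarith
  have row2: "(\<Sum>j\<in>UNIV. (b i j)\<^sup>2) \<le> \<sigma>\<^sup>2" for i
    using row[of i] by (simp add: sqrt_le_D)
  have l: "0 < ?l" using assms by simp
  have n: "1 \<le> ?n" by (simp add: Suc_leI)
  have "expectation (\<lambda>\<omega>. spec_norm (gauss_sym_matrix g b \<omega>))
     \<le> (1 + \<epsilon>) * (2 * \<sigma> + 6 / sqrt ?l * \<tau> * sqrt (ln (real ?n)))"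
  \<comment> \<open>In dimension one the logarithmic term vanishes and the second moment alone gives
    the bound \<sigma>.\<close>
  proof (cases "?n = 1")
    case True
    have "expectation (\<lambda>\<omega>. trace_power UNIV (X b \<omega>) (2 * 1)) \<le> (\<Sum>i\<in>(UNIV :: 'n set). \<sigma>\<^sup>2)"
      using expectation_trace_2[OF b_sym] by (simp del: sum_constant) (intro sum_mono row2)
    then have "expectation (\<lambda>\<omega>. spec_norm (gauss_sym_matrix g b \<omega>)) \<le> \<sigma>"
      using \<sigma>0 True by (intro expectation_spec_norm_le[where p = 1] b_sym) auto
    also have "\<dots> \<le> (1 + \<epsilon>) * (2 * \<sigma>)"
      using mult_mono[of 1 "1 + \<epsilon>" \<sigma> "2 * \<sigma>"] \<sigma>0 assms by simp
    finally show ?thesis using True by simp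
  next
    case False
    then have n2: "2 \<le> ?n" using n by linarith
    have rhs0: "0 \<le> (1 + \<epsilon>) * (2 * \<sigma> + 6 / sqrt ?l * \<tau> * sqrt (ln (real ?n)))"
      using \<sigma>0 \<tau>0 l n assms by (intro mult_nonneg_nonneg add_nonneg_nonneg) auto
    show ?thesis
    \<comment> \<open>Normalising divides by \<tau>; if \<tau> is zero, so is the matrix.\<close>
    proof (cases "\<tau> = 0")
      case True
      then have b0: "b i j = 0" for i j using entry[of i j] by simp
      have "X b \<omega> i j = 0" for \<omega> i j by (simp add: gauss_sym_matrix_def b0)
      then have "spec_norm (gauss_sym_matrix g b \<omega>) = 0" for \<omega>
        using spec_norm_le_sum[of "gauss_sym_matrix g b \<omega>"] spec_norm_nonneg[of "gauss_sym_matrix g b \<omega>"]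
        by simp
      then show ?thesis using rhs0 by simp
    next
      case False
      then have \<tau>: "0 < \<tau>" using \<tau>0 by simp
      define c s where "c i j = b i j / \<tau>" and "s = \<sigma> / \<tau>" for i j
      have c_sym: "c i j = c j i" for i j using b_sym[of i j] by (simp add: c_def)
      have c1: "\<bar>c i j\<bar> \<le> 1" for i j using entry[of i j] \<tau> by (simp add: c_def)
      have c_row: "(\<Sum>j\<in>UNIV. (c i j)\<^sup>2) \<le> s\<^sup>2" for i
        using row2[of i] \<tau> by (simp add: c_def s_def power_divide sum_divide_distrib[symmetric] divide_right_mono)
      \<comment> \<open>The row that contains an entry of maximal modulus has positive norm.\<close>
      have "0 < \<sigma>"
      proof -
        have "\<tau> \<in> range (\<lambda>p. \<bar>b (fst p) (snd p)\<bar>)" unfolding \<tau>_def by (rule Max_in) auto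
        then obtain i j where "\<tau> = \<bar>b i j\<bar>" by auto
        then have "0 < (b i j)\<^sup>2" using \<tau> by auto
        also have "\<dots> \<le> (\<Sum>j\<in>UNIV. (b i j)\<^sup>2)" by (rule member_le_sum) auto
        also have "\<dots> \<le> \<sigma>\<^sup>2" by (rule row2)
        finally show ?thesis using \<sigma>0 by (cases "\<sigma> = 0") auto
      qed
      then have s0: "0 < s" using \<tau> by (simp add: s_def)
      obtain p :: nat where p: "1 \<le> p" "real ?n \<le> (1 + \<epsilon>) ^ (2 * p)" "real p \<le> ln (real ?n) / ?l"
        using moment_order_exists[OF n2] assms by metis
      have "expectation (\<lambda>\<omega>. trace_power UNIV (X c \<omega>) (2 * p)) \<le> real ?n * (2 * s + 6 * sqrt (real p)) ^ (2 * p)"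
        by (rule expectation_trace_le[OF c_sym c1 c_row s0 p(1)])
      also have "\<dots> \<le> (1 + \<epsilon>) ^ (2 * p) * (2 * s + 6 * sqrt (real p)) ^ (2 * p)"
        using p s0 by (intro mult_right_mono) auto
      also have "\<dots> = ((1 + \<epsilon>) * (2 * s + 6 * sqrt (real p))) ^ (2 * p)"
        by (rule power_mult_distrib[symmetric])
      finally have E: "expectation (\<lambda>\<omega>. spec_norm (gauss_sym_matrix g c \<omega>)) \<le> (1 + \<epsilon>) * (2 * s + 6 * sqrt (real p))"
        using s0 assms p by (intro expectation_spec_norm_le[where p = p] c_sym) auto
      have "gauss_sym_matrix g b \<omega> = \<tau> *\<^sub>R gauss_sym_matrix g c \<omega>" for \<omega>
        using \<tau> by (simp add: gauss_sym_matrix_def c_def vec_eq_iff)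
      then have "expectation (\<lambda>\<omega>. spec_norm (gauss_sym_matrix g b \<omega>))
          = \<tau> * expectation (\<lambda>\<omega>. spec_norm (gauss_sym_matrix g c \<omega>))"
        using \<tau> by (simp add: spec_norm_scaleR)
      also have "\<dots> \<le> \<tau> * ((1 + \<epsilon>) * (2 * s + 6 * sqrt (real p)))"
        using E \<tau> by (intro mult_left_mono) auto
      also have "\<dots> = (1 + \<epsilon>) * (2 * \<sigma> + 6 * sqrt (real p) * \<tau>)"
        using \<tau> by (simp add: s_def field_simps)
      also have "\<dots> \<le> (1 + \<epsilon>) * (2 * \<sigma> + 6 * (sqrt (ln (real ?n)) / sqrt ?l) * \<tau>)"
        using p(3) assms \<tau> by (intro mult_left_mono add_left_mono mult_right_mono)
          (auto simp: real_sqrt_divide[symmetric])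
      finally show ?thesis by (simp add: mult_ac)
    qed
  qed
  then show ?thesis using integrable_spec_norm[OF b_sym] by (simp add: \<sigma>_def \<tau>_def)
qed

end
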